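(* Let $\mathcal{L}\subset\mathbb{R}^d$ be a full-rank lattice. (a) For any compact sets $A, B\subset\mathbb{R}^d$, \[ \sum_{n \in \operatorname{int}(A-B) \cap \mathcal{L} } \operatorname{vol}\big(A\cap(B+n)\big) =\frac{1}{\det \mathcal{L}} \operatorname{vol} A \operatorname{vol} B + \frac{1}{\det \mathcal{L}} \sum_{\xi \in \mathcal{L}^* \setminus \{0\}} \hat{1}_{A}(\xi)\,\overline{\hat{1}_{B}(\xi)}. \] (b) If $\mathcal{P}\subset\mathbb{R}^d$ is a compact, convex, centrally symmetric set, then \[ \sum_{n \in \operatorname{int}(\mathcal{P}) \cap \mathcal{L} } \operatorname{vol}\big(\mathcal{P}\cap(\mathcal{P}+2n)\big) =\frac{1}{\det \mathcal{L}} \frac{\operatorname{vol}^{2} \mathcal{P}}{2^{d}} + \frac{2^d}{\det \mathcal{L}} \sum_{\xi \in \mathcal{L}^* \setminus\{0\}}\left|\hat{1}_{\frac{1}{2} \mathcal{P}}(\xi)\right|^{2}. \]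
   Context: $A-B=\{a-b:a\in A,b\in B\}$; $\operatorname{int}$ denotes interior; $\operatorname{vol}$ is Lebesgue measure. The Fourier transform is $\hat h(\xi)=\int_{\mathbb{R}^d} h(x)e^{-2\pi i\langle x,\xi\rangle}\,dx$ and $1_S$ is the indicator function of $S$. $\det\mathcal{L}$ is the covolume of $\mathcal{L}$ and $\mathcal{L}^*=\{\xi:\langle\xi,n\rangle\in\mathbb{Z}\ \forall n\in\mathcal{L}\}$ is the dual lattice. Centrally symmetric means $\mathcal{P}=-\mathcal{P}$. *)

theory Defs
  imports "HOL-Analysis.Analysis"
begin

definition lattice_of :: "real ^ 'n ^ 'n \<Rightarrow> (real ^ 'n) set" where
  "lattice_of M = {M *v z | z. \<forall>i. z $ i \<in> \<int>}"

text \<open>The columns of the invertible matrix \<open>M\<close> are a lattice basis.\<close>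

definition full_rank_lattice :: "(real ^ 'n) set \<Rightarrow> bool" where
  "full_rank_lattice L \<longleftrightarrow> (\<exists>M. invertible M \<and> L = lattice_of M)"

text \<open>The value does not depend on the chosen basis: see \<open>covolume_lattice_of\<close> below.\<close>

definition covolume :: "(real ^ 'n) set \<Rightarrow> real" where
  "covolume L = (THE c. \<exists>M. invertible M \<and> L = lattice_of M \<and> c = \<bar>det M\<bar>)"

definition dual_lattice :: "(real ^ 'n) set \<Rightarrow> (real ^ 'n) set" where
  "dual_lattice L = {\<xi>. \<forall>n\<in>L. \<xi> \<bullet> n \<in> \<int>}"

definition fourier :: "(real ^ 'n \<Rightarrow> complex) \<Rightarrow> real ^ 'n \<Rightarrow> complex" where
  "fourier h \<xi> = (LINT x|lebesgue. h x * exp (- 2 * of_real pi * \<i> * of_real (x \<bullet> \<xi>)))"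

abbreviation vol :: "(real ^ 'n) set \<Rightarrow> real" where
  "vol S \<equiv> measure lebesgue S"

definition difference_set :: "(real ^ 'n) set \<Rightarrow> (real ^ 'n) set \<Rightarrow> (real ^ 'n) set" where
  "difference_set A B = {a - b | a b. a \<in> A \<and> b \<in> B}"

definition translate :: "(real ^ 'n) set \<Rightarrow> real ^ 'n \<Rightarrow> (real ^ 'n) set" where
  "translate S v = (\<lambda>x. x + v) ` S"

definition centrally_symmetric :: "(real ^ 'n) set \<Rightarrow> bool" where
  "centrally_symmetric P \<longleftrightarrow> P = uminus ` P"

lemma abs_det_le_if_lattice_subset:
  fixes A B :: "real ^ 'n ^ 'n"
  assumes "invertible A" and "lattice_of A \<subseteq> lattice_of B"
  shows "\<bar>det B\<bar> \<le> \<bar>det A\<bar>"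
proof -
  have "\<exists>z. column j A = B *v z \<and> (\<forall>i. z $ i \<in> \<int>)" for j
  proof -
    have "A *v axis j 1 \<in> lattice_of A"
      unfolding lattice_of_def by (auto simp: axis_def intro!: exI[of _ "axis j 1"])
    then have "column j A \<in> lattice_of B"
      using assms(2) by (auto simp: matrix_vector_mult_basis)
    then show ?thesis by (auto simp: lattice_of_def)
  qed
  then obtain z where z: "\<And>j. column j A = B *v z j" "\<And>j i. z j $ i \<in> \<int>"
    by metis
  define U where "U = (\<chi> i j. z j $ i)"
  have "A = B ** U"
  proof -
    have "A $ i $ j = (B ** U) $ i $ j" for i j
    proof -
      have "A $ i $ j = column j A $ i" by (simp add: column_def)
      also have "\<dots> = (B ** U) $ i $ j"
        by (simp add: z(1) U_def matrix_matrix_mult_def matrix_vector_mult_def)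
      finally show ?thesis .
    qed
    then show ?thesis by (simp add: vec_eq_iff)
  qed
  then have det: "det A = det B * det U" by (simp add: det_mul)
  have "det U \<in> \<int>"
    unfolding det_def U_def by (auto intro!: Ints_sum Ints_mult Ints_prod z(2))
  moreover have "det U \<noteq> 0"
    using assms(1) det by (auto simp: invertible_det_nz)
  ultimately have "1 \<le> \<bar>det U\<bar>" by (rule Ints_nonzero_abs_ge1)
  then have "\<bar>det B\<bar> * 1 \<le> \<bar>det B\<bar> * \<bar>det U\<bar>" by (intro mult_left_mono) auto
  then show ?thesis by (simp add: det abs_mult)
qed

lemma covolume_lattice_of:
  fixes M :: "real ^ 'n ^ 'n"
  assumes "invertible M"
  shows "covolume (lattice_of M) = \<bar>det M\<bar>"
  unfolding covolume_def
proof (rule the_equality)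
  show "\<exists>M'. invertible M' \<and> lattice_of M = lattice_of M' \<and> \<bar>det M\<bar> = \<bar>det M'\<bar>"
    using assms by blast
next
  fix c assume "\<exists>M'. invertible M' \<and> lattice_of M = lattice_of M' \<and> c = \<bar>det M'\<bar>"
  then obtain M' where M': "invertible M'" "lattice_of M = lattice_of M'" "c = \<bar>det M'\<bar>"
    by blast
  show "c = \<bar>det M\<bar>"
    using abs_det_le_if_lattice_subset[of M M'] abs_det_le_if_lattice_subset[of M' M] assms M'
    by simp
qed

end

(* A linear change of variables reduces the lattice to the integers. There the function
   f x = vol (A \<inter> (B + x)) is continuous with compact support, and its Fourier transform is the
   product of the transform of A with the conjugate of that of B. Integrating f against the
   d-dimensional Fejer kernel K_N over the whole space gives, on the one hand, a finite sum of these
   transform values at integer points with weights in [0, 1] tending to 1; on the other hand, cutting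
   the space into unit cells, the integrals tend to the sum of f over the integer points, as K_N is
   periodic and an approximate identity on a cell. For A = B the terms are nonnegative, so their
   partial sums are bounded; this gives square summability of the transforms, hence absolute
   summability for A and B, and dominated convergence identifies the two limits.
   Part (b) is part (a) for A = B = P and the lattice 2L, since P - P = 2P. *)
theory Submission
  imports Defs
begin

section \<open>Linear change of variables\<close>

text \<open>The function \<open>f\<close> is only known to be continuous, and no decay of the
  transforms of the indicators is available in advance, so summation formulas for smooth or rapidly
  decaying functions do not apply. The Fejer kernel answers this in two ways. It is nonnegative with
  mass 1 on a cell, so continuity of \<open>f\<close> suffices for convergence. Its coefficients are
  nonnegative and finitely supported, so for A = B every weighted sum over a finite set of
  frequencies stays below the integral, whose limit is a finite sum of volumes. The sum runs over
  the interior of A - B because the set where \<open>f\<close> is nonzero is open and lies in A - B,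
  hence in its interior. The factor 1 / det comes from scaling: under the change of variables each
  of the two transforms gains a factor d, each intersection volume gains one d, so products of
  transforms carry d^2 against d on the other side.\<close>

lemma measurable_vec_lambda_PiM [measurable]:
  "vec_lambda \<in> borel_measurable (\<Pi>\<^sub>M i\<in>(UNIV::'n::finite set). (lborel::real measure))"
proof (rule borel_measurable_euclidean_space[THEN iffD2], safe)
  fix b :: "real ^ 'n" assume "b \<in> Basis"
  then obtain i where "b = axis i 1" by (auto simp: Basis_vec_def)
  then have "(\<lambda>x::'n \<Rightarrow> real. vec_lambda x \<bullet> b) = (\<lambda>x. x i)"
    by (auto simp: inner_axis)
  then show "(\<lambda>x. vec_lambda x \<bullet> b) \<in> borel_measurable (\<Pi>\<^sub>M i\<in>(UNIV::'n set). (lborel::real measure))"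
    by simp
qed

lemma prod_Basis_cart:
  fixes x :: "real ^ 'n"
  shows "(\<Prod>b\<in>Basis. x \<bullet> b) = (\<Prod>i\<in>UNIV. x $ i)"
proof -
  have B: "(Basis :: (real ^ 'n) set) = (\<lambda>i. axis i 1) ` UNIV"
    by (auto simp: Basis_vec_def)
  have "inj_on (\<lambda>i. axis i 1 :: real ^ 'n) UNIV"
    by (auto simp: inj_on_def axis_eq_axis)
  then show ?thesis
    unfolding B by (subst prod.reindex) (auto simp: cart_eq_inner_axis)
qed

text \<open>Both measures give a box the product of its side lengths, and this determines
  \<open>lborel\<close>. The identification makes integration one coordinate at a time
  available.\<close>

lemma lborel_eq_distr_vec_lambda:
  "(lborel :: (real ^ 'n) measure) = distr (\<Pi>\<^sub>M i\<in>(UNIV::'n set). lborel) borel vec_lambda"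
proof (rule lborel_eqI)
  interpret P: finite_product_sigma_finite "\<lambda>_::'n. lborel::real measure" UNIV
    by standard auto
  fix l u :: "real ^ 'n"
  assume le: "\<And>b. b \<in> Basis \<Longrightarrow> l \<bullet> b \<le> u \<bullet> b"
  have le': "l $ i \<le> u $ i" for i
    using le[of "axis i 1"] by (auto simp: inner_axis Basis_vec_def)
  have eq: "vec_lambda -` box l u \<inter> space (\<Pi>\<^sub>M i\<in>(UNIV::'n set). (lborel::real measure))
      = (\<Pi>\<^sub>E i\<in>UNIV. {l $ i<..<u $ i})"
    by (auto simp: mem_box_cart space_PiM PiE_iff)
  have "emeasure (distr (\<Pi>\<^sub>M i\<in>(UNIV::'n set). lborel) borel vec_lambda) (box l u)
      = (\<Prod>i\<in>UNIV. emeasure lborel {l $ i<..<u $ i})"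
    by (subst emeasure_distr) (simp_all add: eq P.measure_times)
  also have "\<dots> = ennreal (\<Prod>b\<in>Basis. (u - l) \<bullet> b)"
    using le' prod_Basis_cart[of "u - l"] by (simp add: prod_ennreal)
  finally show "emeasure (distr (\<Pi>\<^sub>M i\<in>(UNIV::'n set). lborel) borel vec_lambda) (box l u)
      = (\<Prod>b\<in>Basis. (u - l) \<bullet> b)" .
qed simp

lemma nn_integral_prod_cart:
  fixes f :: "'n::finite \<Rightarrow> real \<Rightarrow> ennreal"
  assumes [measurable]: "\<And>i. f i \<in> borel_measurable borel"
  shows "(\<integral>\<^sup>+x. (\<Prod>i\<in>UNIV. f i (x $ i)) \<partial>lborel) = (\<Prod>i\<in>UNIV. \<integral>\<^sup>+t. f i t \<partial>lborel)"
proof -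
  interpret P: product_sigma_finite "\<lambda>_::'n. lborel::real measure"
    by (simp add: product_sigma_finite_def sigma_finite_lborel)
  have "(\<integral>\<^sup>+x. (\<Prod>i\<in>UNIV. f i (x $ i)) \<partial>lborel)
      = (\<integral>\<^sup>+x. (\<Prod>i\<in>UNIV. f i (vec_lambda x $ i)) \<partial>(\<Pi>\<^sub>M i\<in>UNIV. lborel))"
    unfolding lborel_eq_distr_vec_lambda by (rule nn_integral_distr) measurable
  also have "\<dots> = (\<Prod>i\<in>UNIV. \<integral>\<^sup>+t. f i t \<partial>lborel)"
    using P.product_nn_integral_prod[of UNIV f] by simp
  finally show ?thesis .
qed

text \<open>Integrate over coordinate \<open>m\<close> first, with the others fixed. As
  \<open>n\<close> differs from \<open>m\<close>, the shear is then a translation of the line by the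
  constant \<open>x n\<close>.\<close>

lemma nn_integral_shear_cart:
  fixes g :: "real ^ 'n \<Rightarrow> ennreal"
  assumes [measurable]: "g \<in> borel_measurable borel" and "m \<noteq> n"
  shows "(\<integral>\<^sup>+x. g (\<chi> i. if i = m then x $ m + x $ n else x $ i) \<partial>lborel) = (\<integral>\<^sup>+x. g x \<partial>lborel)"
proof -
  interpret P: product_sigma_finite "\<lambda>_::'n. lborel::real measure"
    by (simp add: product_sigma_finite_def sigma_finite_lborel)
  let ?R = "UNIV - {m}"
  have U: "(UNIV :: 'n set) = insert m ?R" by auto
  have fubini: "(\<integral>\<^sup>+x. h x \<partial>lborel)
      = (\<integral>\<^sup>+x. (\<integral>\<^sup>+y. h (vec_lambda (x(m := y))) \<partial>lborel) \<partial>(\<Pi>\<^sub>M i\<in>?R. lborel))"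
    if [measurable]: "h \<in> borel_measurable borel" for h :: "real ^ 'n \<Rightarrow> ennreal"
  proof -
    have "(\<integral>\<^sup>+x. h x \<partial>lborel) = (\<integral>\<^sup>+x. h (vec_lambda x) \<partial>(\<Pi>\<^sub>M i\<in>UNIV. lborel))"
      unfolding lborel_eq_distr_vec_lambda by (rule nn_integral_distr) measurable
    also have "\<dots> = (\<integral>\<^sup>+x. h (vec_lambda x) \<partial>(\<Pi>\<^sub>M i\<in>insert m ?R. lborel))"
      using U by simp
    also have "\<dots> = (\<integral>\<^sup>+x. (\<integral>\<^sup>+y. h (vec_lambda (x(m := y))) \<partial>lborel) \<partial>(\<Pi>\<^sub>M i\<in>?R. lborel))"
    proof (rule P.product_nn_integral_insert)
      show "(\<lambda>x. h (vec_lambda x)) \<in> borel_measurable (\<Pi>\<^sub>M i\<in>insert m ?R. lborel)"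
        unfolding U[symmetric] by measurable
    qed auto
    finally show ?thesis .
  qed
  let ?s = "\<lambda>x::real^'n. \<chi> i. if i = m then x $ m + x $ n else x $ i"
  have "linear ?s"
    by (rule linearI) (auto simp: vec_eq_iff algebra_simps)
  then have [measurable]: "?s \<in> borel_measurable borel"
    by (intro borel_measurable_continuous_onI linear_continuous_on linear_conv_bounded_linear[THEN iffD1])
  have "(\<integral>\<^sup>+x. g (?s x) \<partial>lborel)
      = (\<integral>\<^sup>+x. (\<integral>\<^sup>+y. g (?s (vec_lambda (x(m := y)))) \<partial>lborel) \<partial>(\<Pi>\<^sub>M i\<in>?R. lborel))"
    by (rule fubini) measurable
  also have "\<dots> = (\<integral>\<^sup>+x. (\<integral>\<^sup>+y. g (vec_lambda (x(m := y))) \<partial>lborel) \<partial>(\<Pi>\<^sub>M i\<in>?R. lborel))"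
  proof (rule nn_integral_cong)
    fix x :: "'n \<Rightarrow> real"
    have [measurable]: "(\<lambda>y. g (vec_lambda (x(m := y)))) \<in> borel_measurable borel"
    proof -
      have "(\<lambda>y. vec_lambda (x(m := y))) = (\<lambda>y. vec_lambda x + (y - x m) *\<^sub>R axis m 1)"
        by (auto simp: vec_eq_iff axis_def)
      moreover have "(\<lambda>y. vec_lambda x + (y - x m) *\<^sub>R axis m 1 :: real ^ 'n) \<in> borel_measurable borel"
        by measurable
      ultimately have "(\<lambda>y. vec_lambda (x(m := y))) \<in> borel_measurable borel" by simp
      then show ?thesis by measurable
    qed
    \<comment> \<open>The factor 1 brings the argument into the shape t + c * y of the
      one-dimensional affine substitution.\<close>
    have "?s (vec_lambda (x(m := y))) = vec_lambda (x(m := x n + 1 * y))" for y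
      using \<open>m \<noteq> n\<close> by (auto simp: vec_eq_iff)
    then have "(\<integral>\<^sup>+y. g (?s (vec_lambda (x(m := y)))) \<partial>lborel)
        = (\<integral>\<^sup>+y. g (vec_lambda (x(m := x n + 1 * y))) \<partial>lborel)"
      by presburger
    also have "\<dots> = (\<integral>\<^sup>+y. g (vec_lambda (x(m := y))) \<partial>lborel)"
      by (subst (2) nn_integral_real_affine[of _ 1 "x n"]) auto
    finally show "(\<integral>\<^sup>+y. g (?s (vec_lambda (x(m := y)))) \<partial>lborel)
        = (\<integral>\<^sup>+y. g (vec_lambda (x(m := y))) \<partial>lborel)" .
  qed
  also have "\<dots> = (\<integral>\<^sup>+x. g x \<partial>lborel)"
    by (rule fubini[symmetric]) measurable
  finally show ?thesis .
qed

text \<open>Swapping two coordinates maps boxes to boxes and only permutes the side lengths.\<close>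

lemma lborel_distr_transpose_cart:
  "distr lborel borel (\<lambda>x::real^'n. \<chi> i. x $ Transposition.transpose m n i) = lborel"
proof (rule lborel_eqI[symmetric])
  let ?s = "\<lambda>x::real^'n. \<chi> i. x $ Transposition.transpose m n i"
  have "linear ?s"
    by (rule linearI) (auto simp: vec_eq_iff)
  then have [measurable]: "?s \<in> borel_measurable borel"
    by (intro borel_measurable_continuous_onI linear_continuous_on linear_conv_bounded_linear[THEN iffD1])
  fix l u :: "real ^ 'n"
  assume le: "\<And>b. b \<in> Basis \<Longrightarrow> l \<bullet> b \<le> u \<bullet> b"
  have le': "l $ i \<le> u $ i" for i
    using le[of "axis i 1"] by (auto simp: inner_axis Basis_vec_def)
  have "?s -` box l u = box (?s l) (?s u)"
    by (auto simp: mem_box_cart) (metis transpose_involutory)+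
  moreover have "(\<Prod>b\<in>Basis. (?s u - ?s l) \<bullet> b) = (\<Prod>b\<in>Basis. (u - l) \<bullet> b)"
  proof -
    have "(\<Prod>b\<in>Basis. (?s u - ?s l) \<bullet> b) = (\<Prod>i\<in>UNIV. (u - l) $ Transposition.transpose m n i)"
      using prod_Basis_cart[of "?s u - ?s l"] by simp
    also have "\<dots> = (\<Prod>i\<in>UNIV. (u - l) $ i)"
      by (rule prod.reindex_bij_betw) simp
    also have "\<dots> = (\<Prod>b\<in>Basis. (u - l) \<bullet> b)"
      using prod_Basis_cart[of "u - l"] by simp
    finally show ?thesis .
  qed
  moreover have "?s l \<bullet> b \<le> ?s u \<bullet> b" if "b \<in> Basis" for b
    using that le' by (auto simp: Basis_vec_def inner_axis)
  ultimately show "emeasure (distr lborel borel ?s) (box l u) = (\<Prod>b\<in>Basis. (u - l) \<bullet> b)"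
    by (simp add: emeasure_distr emeasure_lborel_box_eq)
qed simp

text \<open>The library's linear change of variables requires a well-ordered index type, whereas the
  lattice lives over an arbitrary finite one.\<close>

lemma nn_integral_linear_cart:
  fixes f :: "real ^ 'n \<Rightarrow> real ^ 'n"
  assumes "linear f" "det (matrix f) \<noteq> 0" "g \<in> borel_measurable borel"
  shows "ennreal \<bar>det (matrix f)\<bar> * (\<integral>\<^sup>+x. g (f x) \<partial>lborel) = (\<integral>\<^sup>+x. g x \<partial>lborel)"
proof -
  \<comment> \<open>The determinant condition and all \<open>g\<close> belong to the induction
    predicate: for a composition the inner map is applied to the integrand \<open>g\<close> composed
    with the outer map, and both determinants are nonzero because their product is.\<close>
  have "linear f \<longrightarrow> det (matrix f) \<noteq> 0 \<longrightarrow> (\<forall>g\<in>borel_measurable borel.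
     ennreal \<bar>det (matrix f)\<bar> * (\<integral>\<^sup>+x. g (f x) \<partial>lborel) = (\<integral>\<^sup>+x. g x \<partial>lborel))"
    (is "?P f")
  proof (rule induct_linear_elementary[OF assms(1)])
    fix f1 f2 :: "real ^ 'n \<Rightarrow> real ^ 'n"
    assume lin: "linear f1" "linear f2" and P: "?P f1" "?P f2"
    have det: "det (matrix (f1 \<circ> f2)) = det (matrix f1) * det (matrix f2)"
      using lin by (simp add: matrix_compose det_mul)
    have [measurable]: "f1 \<in> borel_measurable borel" "f2 \<in> borel_measurable borel"
      using lin by (auto intro!: borel_measurable_continuous_onI linear_continuous_on
          linear_conv_bounded_linear[THEN iffD1])
    show "?P (f1 \<circ> f2)"
    proof (intro impI ballI)
      fix g :: "real ^ 'n \<Rightarrow> ennreal"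
      assume nz: "det (matrix (f1 \<circ> f2)) \<noteq> 0" and [measurable]: "g \<in> borel_measurable borel"
      have "ennreal \<bar>det (matrix f2)\<bar> * (\<integral>\<^sup>+x. g (f1 (f2 x)) \<partial>lborel) = (\<integral>\<^sup>+x. g (f1 x) \<partial>lborel)"
        using P(2)[rule_format, of "\<lambda>x. g (f1 x)"] lin nz det by simp
      moreover have "ennreal \<bar>det (matrix f1)\<bar> * (\<integral>\<^sup>+x. g (f1 x) \<partial>lborel) = (\<integral>\<^sup>+x. g x \<partial>lborel)"
        using P(1) lin nz det by simp
      ultimately show "ennreal \<bar>det (matrix (f1 \<circ> f2))\<bar> * (\<integral>\<^sup>+x. g ((f1 \<circ> f2) x) \<partial>lborel) = (\<integral>\<^sup>+x. g x \<partial>lborel)"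
        by (simp add: det abs_mult ennreal_mult mult.assoc)
    qed
  next
    fix f1 :: "real ^ 'n \<Rightarrow> real ^ 'n" and i
    assume "linear f1" and z: "\<And>x. f1 x $ i = 0"
    \<comment> \<open>A vanishing coordinate rules out surjectivity, hence injectivity, so the
      determinant is 0 and this case is vacuous.\<close>
    then have "\<not> inj f1"
      by (metis (full_types) linear_injective_imp_surjective one_neq_zero surjE vec_component)
    then show "?P f1"
      using det_nz_iff_inj by blast
  next
    fix c :: "'n \<Rightarrow> real"
    let ?f = "\<lambda>x::real^'n. \<chi> i. c i * x $ i"
    have m: "matrix ?f = (\<chi> i j. if i = j then c i else 0)"
      by (auto simp: vec_eq_iff matrix_def axis_def)
    have det: "det (matrix ?f) = prod c UNIV"
      by (simp add: m det_diagonal)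
    show "?P ?f"
    proof (intro impI ballI)
      fix g :: "real ^ 'n \<Rightarrow> ennreal"
      assume nz: "det (matrix ?f) \<noteq> 0" and [measurable]: "g \<in> borel_measurable borel"
      have B: "(Basis :: (real ^ 'n) set) = (\<lambda>i. axis i 1) ` UNIV"
        by (auto simp: Basis_vec_def)
      have inj: "inj_on (\<lambda>i. axis i 1 :: real ^ 'n) UNIV"
        by (auto simp: inj_on_def axis_eq_axis)
      let ?c = "\<lambda>b::real^'n. c (axis_index b)"
      have cb: "(\<Prod>b\<in>Basis. \<bar>?c b\<bar>) = \<bar>det (matrix ?f)\<bar>"
        unfolding B det by (simp add: prod.reindex inj abs_prod)
      have "(\<lambda>x. 0 + (\<Sum>b\<in>Basis. (?c b * (x \<bullet> b)) *\<^sub>R b)) = ?f"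
        unfolding B sum.reindex[OF inj]
        by (auto simp: vec_eq_iff inner_axis fun_eq_iff axis_def[of _ "1::real", THEN arg_cong[where f="\<lambda>v. v $ _"]] if_distrib cong: if_cong)
      moreover have "?c b \<noteq> 0" if "b \<in> Basis" for b
        using nz det by simp
      ultimately have L: "lborel = density (distr lborel borel ?f) (\<lambda>_. ennreal \<bar>det (matrix ?f)\<bar>)"
        using lborel_affine_euclidean[of ?c 0] by (simp add: cb)
      have [measurable]: "?f \<in> borel_measurable borel"
        by (intro borel_measurable_continuous_onI continuous_intros)
      show "ennreal \<bar>det (matrix ?f)\<bar> * (\<integral>\<^sup>+x. g (?f x) \<partial>lborel) = (\<integral>\<^sup>+x. g x \<partial>lborel)"
        by (subst (2) L) (simp add: nn_integral_density nn_integral_distr nn_integral_cmult)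
    qed
  next
    fix m n :: 'n assume "m \<noteq> n"
    let ?f = "\<lambda>x::real^'n. \<chi> i. x $ Transposition.transpose m n i"
    have lin: "linear ?f"
      by (rule linearI) (auto simp: vec_eq_iff)
    then have [measurable]: "?f \<in> borel_measurable borel"
      by (intro borel_measurable_continuous_onI linear_continuous_on linear_conv_bounded_linear[THEN iffD1])
    \<comment> \<open>Up to transposition the matrix is the identity with two rows exchanged, so its
      determinant is a sign.\<close>
    have "matrix ?f = transpose (\<chi> i j. if i = Transposition.transpose m n j then 1 else 0)"
      by (auto simp: matrix_def axis_def transpose_def vec_eq_iff)
    moreover have "(\<chi> i j. if i = Transposition.transpose m n j then 1 else 0)
        = (\<chi> i. (mat 1 :: real ^ 'n ^ 'n) $ Transposition.transpose m n i)"
      by (auto simp: vec_eq_iff mat_def transpose_eq_iff)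
    ultimately have "\<bar>det (matrix ?f)\<bar> = 1"
      using det_permute_rows[of "Transposition.transpose m n" "mat 1 :: real^'n^'n"] \<open>m \<noteq> n\<close>
      by (simp add: permutes_swap_id sign_swap_id)
    moreover have "(\<integral>\<^sup>+x. g (?f x) \<partial>lborel) = (\<integral>\<^sup>+x. g x \<partial>lborel)"
      if [measurable]: "g \<in> borel_measurable borel" for g :: "real ^ 'n \<Rightarrow> ennreal"
      by (subst (2) lborel_distr_transpose_cart[of m n, symmetric]) (simp add: nn_integral_distr)
    ultimately show "?P ?f" by simp
  next
    fix m n :: 'n assume mn: "m \<noteq> n"
    let ?f = "\<lambda>x::real^'n. \<chi> i. if i = m then x $ m + x $ n else x $ i"
    have "matrix ?f = (\<chi> k. if k = m then row m (mat 1) + 1 *s row n (mat 1) else row k (mat 1))"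
      by (auto simp: matrix_def axis_def row_def mat_def vec_eq_iff)
    then have "det (matrix ?f) = 1"
      using det_row_operation[OF mn, of "mat 1" 1] by simp
    then show "?P ?f"
      using mn nn_integral_shear_cart[of _ m n] by simp
  qed
  then show ?thesis using assms by blast
qed

lemma lborel_linear_cart:
  fixes M :: "real ^ 'n ^ 'n"
  assumes "invertible M"
  shows "lborel = density (distr lborel borel ((*v) M)) (\<lambda>_. ennreal \<bar>det M\<bar>)"
proof (rule measure_eqI)
  have [measurable]: "(*v) M \<in> borel_measurable borel"
    by (intro borel_measurable_continuous_onI continuous_intros)
  fix S assume "S \<in> sets (lborel :: (real ^ 'n) measure)"
  then have [measurable]: "S \<in> sets borel" by simp
  have "emeasure lborel S = (\<integral>\<^sup>+x. indicator S x \<partial>lborel)"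
    by simp
  also have "\<dots> = ennreal \<bar>det M\<bar> * (\<integral>\<^sup>+x. indicator S (M *v x) \<partial>lborel)"
    using nn_integral_linear_cart[of "(*v) M" "indicator S"] assms
    by (simp add: invertible_det_nz)
  also have "\<dots> = (\<integral>\<^sup>+x. ennreal \<bar>det M\<bar> * indicator S x \<partial>distr lborel borel ((*v) M))"
    by (subst nn_integral_distr) (auto simp: nn_integral_cmult)
  also have "\<dots> = emeasure (density (distr lborel borel ((*v) M)) (\<lambda>_. ennreal \<bar>det M\<bar>)) S"
    by (rule emeasure_density[symmetric]) auto
  finally show "emeasure lborel S = \<dots>" .
qed simp

lemma integral_linear_cart:
  fixes M :: "real ^ 'n ^ 'n" and h :: "real ^ 'n \<Rightarrow> 'b::{banach, second_countable_topology}"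
  assumes "invertible M" and [measurable]: "h \<in> borel_measurable borel"
  shows "(LINT x|lborel. h x) = \<bar>det M\<bar> *\<^sub>R (LINT x|lborel. h (M *v x))"
proof -
  have [measurable]: "(*v) M \<in> borel_measurable borel"
    by (intro borel_measurable_continuous_onI continuous_intros)
  show ?thesis
    by (subst lborel_linear_cart[OF assms(1)]) (simp add: integral_density integral_distr)
qed

section \<open>The Fejer kernel\<close>

text \<open>The classical Fejer kernel of period 1: for non-integral t it equals (sin (pi N t) / sin
  (pi t))^2 / N. As a squared modulus it is visibly nonnegative.\<close>

definition fejer :: "nat \<Rightarrow> real \<Rightarrow> real" where
  "fejer N t = (cmod (\<Sum>j<N. cis (2 * pi * real j * t)))\<^sup>2 / real N"

lemma fejer_nonneg: "0 \<le> fejer N t"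
  by (simp add: fejer_def)

lemma continuous_fejer: "continuous_on UNIV (fejer N)"
  unfolding fejer_def by (cases "N = 0") (auto intro!: continuous_intros simp: cis_conv_exp)

lemma borel_measurable_fejer [measurable]: "fejer N \<in> borel_measurable borel"
  by (rule borel_measurable_continuous_onI[OF continuous_fejer])

lemma fejer_periodic: "fejer N (t + of_int k) = fejer N t"
proof -
  have "cis (2 * pi * real j * (t + of_int k)) = cis (2 * pi * real j * t)" for j
  proof -
    have "cis (2 * pi * real j * (t + of_int k))
        = cis (2 * pi * real j * t) * cis (2 * pi * of_int (int j * k))"
      by (simp add: cis_mult algebra_simps)
    also have "cis (2 * pi * of_int (int j * k)) = 1"
      by (rule cis_multiple_2pi) simp
    finally show ?thesis by simp
  qed
  then show ?thesis by (simp add: fejer_def)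
qed

text \<open>The difference m = l - j arises from N - |m| pairs. In the induction step the new row,
  column and corner contribute each difference from -N to N exactly once.\<close>

lemma sum_square_diff:
  fixes g :: "int \<Rightarrow> complex"
  shows "(\<Sum>j<N. \<Sum>l<N. g (int l - int j)) = (\<Sum>m\<in>{- int N..int N}. of_real (of_int (int N - \<bar>m\<bar>)) * g m)"
proof (induction N)
  case 0
  show ?case by simp
next
  case (Suc N)
  have "(\<Sum>j<Suc N. \<Sum>l<Suc N. g (int l - int j))
      = (\<Sum>j<N. \<Sum>l<N. g (int l - int j)) + (g 0 + (\<Sum>j<N. g (int N - int j)) + (\<Sum>l<N. g (int l - int N)))"
    by (simp add: sum.distrib algebra_simps)
  also have "g 0 + (\<Sum>j<N. g (int N - int j)) + (\<Sum>l<N. g (int l - int N)) = (\<Sum>m\<in>{- int N..int N}. g m)"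
  proof -
    have "{- int N..int N} = insert 0 ({1..int N} \<union> {- int N.. -1})" by auto
    then have "(\<Sum>m\<in>{- int N..int N}. g m) = g 0 + ((\<Sum>m\<in>{1..int N}. g m) + (\<Sum>m\<in>{- int N.. -1}. g m))"
      by (simp add: sum.union_disjoint)
    moreover have "(\<Sum>j<N. g (int N - int j)) = (\<Sum>m\<in>{1..int N}. g m)"
      by (rule sum.reindex_bij_witness[of _ "\<lambda>m. nat (int N - m)" "\<lambda>j. int N - int j"]) auto
    moreover have "(\<Sum>l<N. g (int l - int N)) = (\<Sum>m\<in>{- int N.. -1}. g m)"
      by (rule sum.reindex_bij_witness[of _ "\<lambda>m. nat (int N + m)" "\<lambda>j. int j - int N"]) auto
    ultimately show ?thesis by simp
  qed
  also have "(\<Sum>j<N. \<Sum>l<N. g (int l - int j)) + (\<Sum>m\<in>{- int N..int N}. g m)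
      = (\<Sum>m\<in>{- int N..int N}. of_real (of_int (int (Suc N) - \<bar>m\<bar>)) * g m)"
    unfolding Suc.IH sum.distrib[symmetric]
    by (rule sum.cong) (auto simp: algebra_simps)
  \<comment> \<open>The two new end points have coefficient 0.\<close>
  also have "\<dots> = (\<Sum>m\<in>{- int (Suc N)..int (Suc N)}. of_real (of_int (int (Suc N) - \<bar>m\<bar>)) * g m)"
  proof (rule sum.mono_neutral_left)
    show "\<forall>m\<in>{- int (Suc N)..int (Suc N)} - {- int N..int N}. of_real (of_int (int (Suc N) - \<bar>m\<bar>)) * g m = 0"
    proof
      fix m assume "m \<in> {- int (Suc N)..int (Suc N)} - {- int N..int N}"
      then have "\<bar>m\<bar> = int (Suc N)" by auto
      then show "of_real (of_int (int (Suc N) - \<bar>m\<bar>)) * g m = 0" by simp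
    qed
  qed auto
  finally show ?case .
qed

text \<open>Expanding the squared modulus leaves characters that depend only on the difference of
  two frequencies. The minus sign in the exponent agrees with the one in
  \<open>fourier\<close>.\<close>

lemma fejer_expansion:
  assumes "N > 0"
  shows "complex_of_real (fejer N t)
    = (\<Sum>m\<in>{- int N..int N}. of_real (1 - \<bar>of_int m\<bar> / real N) * cis (- 2 * pi * of_int m * t))"
proof -
  let ?g = "\<lambda>m::int. cis (- 2 * pi * of_int m * t)"
  have "complex_of_real ((cmod (\<Sum>j<N. cis (2 * pi * real j * t)))\<^sup>2)
      = (\<Sum>j<N. cis (2 * pi * real j * t)) * (\<Sum>l<N. cnj (cis (2 * pi * real l * t)))"
    by (simp only: complex_norm_square cnj_sum)
  also have "\<dots> = (\<Sum>j<N. \<Sum>l<N. ?g (int l - int j))"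
    unfolding sum_product cis_cnj cis_mult by (intro sum.cong refl) (simp add: algebra_simps)
  also have "\<dots> = (\<Sum>m\<in>{- int N..int N}. of_real (of_int (int N - \<bar>m\<bar>)) * ?g m)"
    by (rule sum_square_diff)
  finally have "complex_of_real (fejer N t)
      = (\<Sum>m\<in>{- int N..int N}. of_real (of_int (int N - \<bar>m\<bar>)) * ?g m) / of_real (real N)"
    by (simp add: fejer_def)
  also have "\<dots> = (\<Sum>m\<in>{- int N..int N}. of_real (1 - \<bar>of_int m\<bar> / real N) * ?g m)"
    unfolding sum_divide_distrib using assms by (intro sum.cong refl) (simp add: field_simps)
  finally show ?thesis .
qed

lemma has_integral_cis_period:
  "((\<lambda>t. cis (- 2 * pi * of_int m * t)) has_integral (if m = 0 then 1 else 0)) {-1/2..1/2}"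
proof (cases "m = 0")
  case True
  then show ?thesis
    using has_integral_const_real[of "1::complex" "-1/2" "1/2"] by simp
next
  case False
  let ?c = "- 2 * of_real pi * of_int m * \<i>"
  have c: "?c \<noteq> 0" using False by simp
  have cis: "cis (- 2 * pi * of_int m * t) = exp (?c * of_real t)" for t
    by (simp add: cis_conv_exp mult_ac)
  have "((\<lambda>t. exp (?c * of_real t)) has_integral
      (exp (?c * of_real (1/2)) / ?c - exp (?c * of_real (-1/2)) / ?c)) {-1/2..1/2}"
  proof (rule fundamental_theorem_of_calculus)
    fix x :: real
    have "((\<lambda>z. exp (?c * z) / ?c) has_field_derivative exp (?c * of_real x)) (at (of_real x))"
      using c by (auto intro!: derivative_eq_intros)
    then show "((\<lambda>t. exp (?c * of_real t) / ?c) has_vector_derivative exp (?c * of_real x))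
        (at x within {-1/2..1/2})"
      using has_vector_derivative_real_field has_vector_derivative_at_within by blast
  qed simp
  \<comment> \<open>The antiderivative has period 1, so its values at the two ends cancel.\<close>
  moreover have "exp (?c * of_real (1/2)) = exp (?c * of_real (-1/2))"
  proof -
    have "?c * of_real (1/2) = ?c * of_real (-1/2) + (2 * of_int (-m) * pi) * \<i>"
      by (simp add: algebra_simps)
    then show ?thesis
      using exp_eq[of "?c * of_real (1/2)" "?c * of_real (-1/2)"] by (metis of_int_mult of_int_numeral)
  qed
  ultimately show ?thesis
    using False unfolding cis by simp
qed

text \<open>Only the frequency 0 survives integration over a period, and its weight is 1.\<close>

lemma has_integral_fejer:
  assumes "N > 0"
  shows "(fejer N has_integral 1) {-1/2..1/2}"
proof -
  have "((\<lambda>t. \<Sum>m\<in>{- int N..int N}. of_real (1 - \<bar>of_int m\<bar> / real N) * cis (- 2 * pi * of_int m * t))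
      has_integral (\<Sum>m\<in>{- int N..int N}. of_real (1 - \<bar>of_int m\<bar> / real N) * (if m = 0 then 1 else 0)))
      {-1/2..1/2}"
    by (intro has_integral_sum has_integral_mult_right has_integral_cis_period) auto
  also have "(\<Sum>m\<in>{- int N..int N}. of_real (1 - \<bar>of_int m\<bar> / real N) * (if m = 0 then 1 else 0))
      = (1 :: complex)"
    by (simp add: if_distrib cong: if_cong)
  finally have "((\<lambda>t. complex_of_real (fejer N t)) has_integral 1) {-1/2..1/2}"
    using assms by (simp add: fejer_expansion)
  from has_integral_linear[OF this bounded_linear_Re] show ?thesis
    by (simp add: o_def)
qed

lemma nn_integral_fejer:
  assumes "N > 0"
  shows "(\<integral>\<^sup>+t. indicator {-1/2..<1/2} t * ennreal (fejer N t) \<partial>lborel) = 1"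
proof -
  have "(\<integral>\<^sup>+t. ennreal (indicator {-1/2..1/2} t * fejer N t) \<partial>lborel) = ennreal 1"
    by (rule nn_integral_has_integral_lebesgue[OF _ has_integral_fejer[OF assms]])
      (simp add: fejer_nonneg)
  also have "(\<integral>\<^sup>+t. ennreal (indicator {-1/2..1/2} t * fejer N t) \<partial>lborel)
      = (\<integral>\<^sup>+t. indicator {-1/2..<1/2} t * ennreal (fejer N t) \<partial>lborel)"
    by (rule nn_integral_cong_AE, use AE_lborel_singleton[of "1/2"] in eventually_elim)
       (auto simp: indicator_def)
  finally show ?thesis by simp
qed

text \<open>With z = cis (2 pi t), the geometric sum times 1 - z equals 1 - z^N, which has modulus
  at most 2, while 1 - z has modulus 2 |sin (pi t)|. The sine is increasing up to pi / 2, so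
  \<open>d\<close> may replace \<open>t\<close>.\<close>

lemma fejer_le:
  assumes "0 < d" "d \<le> \<bar>t\<bar>" "\<bar>t\<bar> \<le> 1/2" "N > 0"
  shows "fejer N t \<le> 1 / (real N * (sin (pi * d))\<^sup>2)"
proof -
  let ?z = "cis (2 * pi * t)"
  have sd: "0 < sin (pi * d)"
    using assms by (intro sin_gt_zero) (auto simp: field_simps intro: le_less_trans[of _ "pi * (1/2)"])
  have "sin (pi * d) \<le> sin (pi * \<bar>t\<bar>)"
    using assms pi_gt_zero by (intro sin_monotone_2pi_le) (auto intro: order_trans[of _ 0])
  also have "sin (pi * \<bar>t\<bar>) \<le> \<bar>sin (pi * t)\<bar>"
    by (cases "t \<ge> 0") auto
  finally have sdt: "sin (pi * d) \<le> \<bar>sin (pi * t)\<bar>" .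
  have nz: "cmod (1 - ?z) = 2 * \<bar>sin (pi * t)\<bar>"
  proof -
    have "(cmod (1 - ?z))\<^sup>2 = (1 - cos (2 * (pi * t)))\<^sup>2 + (sin (2 * (pi * t)))\<^sup>2"
      by (simp add: cmod_power2 mult.assoc)
    also have "\<dots> = 2 - 2 * cos (2 * (pi * t))"
      using sin_cos_squared_add[of "2 * (pi * t)"] by (simp add: power2_eq_square algebra_simps)
    also have "\<dots> = (2 * \<bar>sin (pi * t)\<bar>)\<^sup>2"
      by (simp add: cos_double_sin power_mult_distrib)
    finally show ?thesis by (rule power2_eq_imp_eq) auto
  qed
  have "(1 - ?z) * (\<Sum>j<N. ?z ^ j) = 1 - ?z ^ N"
    by (rule one_diff_power_eq[symmetric])
  then have "cmod (1 - ?z) * cmod (\<Sum>j<N. ?z ^ j) \<le> 2"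
    by (metis (no_types, opaque_lifting) norm_mult norm_triangle_ineq4 norm_one norm_cis norm_power power_one one_add_one)
  then have "\<bar>sin (pi * t)\<bar> * cmod (\<Sum>j<N. ?z ^ j) \<le> 1"
    by (simp add: nz)
  then have "sin (pi * d) * cmod (\<Sum>j<N. ?z ^ j) \<le> 1"
    using mult_right_mono[OF sdt, of "cmod (\<Sum>j<N. ?z ^ j)"] by auto
  then have "(sin (pi * d) * cmod (\<Sum>j<N. ?z ^ j))\<^sup>2 \<le> 1"
    using sd by (intro power_le_one) auto
  moreover have "?z ^ j = cis (2 * pi * real j * t)" for j
    by (simp add: Complex.DeMoivre mult_ac)
  ultimately show ?thesis
    using sd assms by (simp add: fejer_def field_simps power_mult_distrib)
qed

lemma nn_integral_fejer_tail:
  assumes "0 < d" "N > 0"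
  shows "(\<integral>\<^sup>+t. indicator ({-1/2..<1/2} \<inter> {t. d \<le> \<bar>t\<bar>}) t * ennreal (fejer N t) \<partial>lborel)
    \<le> ennreal (1 / (real N * (sin (pi * d))\<^sup>2))"
proof -
  let ?C = "1 / (real N * (sin (pi * d))\<^sup>2)"
  have "(\<integral>\<^sup>+t. indicator ({-1/2..<1/2} \<inter> {t. d \<le> \<bar>t\<bar>}) t * ennreal (fejer N t) \<partial>lborel)
      \<le> (\<integral>\<^sup>+t. ennreal ?C * indicator {-1/2..<1/2} (t::real) \<partial>lborel)"
  proof (rule nn_integral_mono)
    fix t :: real
    show "indicator ({-1/2..<1/2} \<inter> {t. d \<le> \<bar>t\<bar>}) t * ennreal (fejer N t)
        \<le> ennreal ?C * indicator {-1/2..<1/2} t"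
      using fejer_le[of d t N] assms by (auto simp: indicator_def abs_le_iff intro!: ennreal_leI)
  qed
  also have "\<dots> = ennreal ?C"
    by (simp add: nn_integral_cmult_indicator)
  finally show ?thesis .
qed

text \<open>Extending the coefficients by 0 beyond the frequency range yields functions on all
  integers, whose limit in \<open>N\<close> can be taken pointwise.\<close>

definition fejer_weight :: "nat \<Rightarrow> int \<Rightarrow> real" where
  "fejer_weight N m = (if \<bar>m\<bar> \<le> int N then 1 - \<bar>of_int m\<bar> / real N else 0)"

lemma fejer_weight_bounds: "0 \<le> fejer_weight N m" "fejer_weight N m \<le> 1"
proof -
  have "real_of_int \<bar>m\<bar> \<le> real N" if "\<bar>m\<bar> \<le> int N"
    using that by linarith
  then show "0 \<le> fejer_weight N m" "fejer_weight N m \<le> 1"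
    by (auto simp: fejer_weight_def divide_le_eq)
qed

lemma fejer_weight_tendsto: "(\<lambda>N. fejer_weight N m) \<longlonglongrightarrow> 1"
proof -
  have "(\<lambda>N. 1 - \<bar>of_int m\<bar> / real N) \<longlonglongrightarrow> 1 - 0"
    by (intro tendsto_intros lim_const_over_n)
  moreover have "\<forall>\<^sub>F N in sequentially. fejer_weight N m = 1 - \<bar>of_int m\<bar> / real N"
    using eventually_ge_at_top[of "nat \<bar>m\<bar>"] by eventually_elim (auto simp: fejer_weight_def)
  ultimately show ?thesis
    by (simp add: tendsto_cong)
qed

text \<open>Half-open, so that the integer translates partition the space without overlap; centred,
  so that the point 0 where the kernel concentrates lies inside.\<close>

definition unit_cell :: "(real ^ 'n) set" where
  "unit_cell = {x. \<forall>i. x $ i \<in> {-1/2..<1/2}}"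

definition fejer_kernel :: "nat \<Rightarrow> real ^ 'n \<Rightarrow> real" where
  "fejer_kernel N x = (\<Prod>i\<in>UNIV. fejer N (x $ i))"

lemma sets_unit_cell [measurable]: "unit_cell \<in> sets borel"
proof -
  have "unit_cell = (\<Inter>i. (\<lambda>x::real^'n. x $ i) -` {-1/2..<1/2} \<inter> space borel)"
    by (auto simp: unit_cell_def)
  also have "\<dots> \<in> sets borel"
    by (intro sets.finite_INT measurable_sets[OF borel_measurable_nth]) auto
  finally show ?thesis .
qed

lemma borel_measurable_fejer_kernel [measurable]: "fejer_kernel N \<in> borel_measurable borel"
  unfolding fejer_kernel_def by measurable

lemma fejer_kernel_nonneg: "0 \<le> fejer_kernel N x"
  by (auto simp: fejer_kernel_def fejer_nonneg intro: prod_nonneg)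

lemma fejer_kernel_periodic:
  "fejer_kernel N (x + (\<chi> i. of_int (h i))) = fejer_kernel N x"
  by (simp add: fejer_kernel_def fejer_periodic)

lemma nn_integral_fejer_kernel:
  assumes "N > 0"
  shows "(\<integral>\<^sup>+x. ennreal (indicator unit_cell x * fejer_kernel N (x::real^'n)) \<partial>lborel) = 1"
proof -
  have "ennreal (indicator unit_cell x * fejer_kernel N x)
      = (\<Prod>i\<in>UNIV. indicator {-1/2..<1/2} (x $ i) * ennreal (fejer N (x $ i)))" for x :: "real^'n"
    by (auto simp: unit_cell_def fejer_kernel_def prod_ennreal fejer_nonneg prod.distrib
        indicator_def prod_zero_iff)
  then have "(\<integral>\<^sup>+x. ennreal (indicator unit_cell x * fejer_kernel N (x::real^'n)) \<partial>lborel)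
      = (\<integral>\<^sup>+x. (\<Prod>i\<in>UNIV. indicator {-1/2..<1/2} (x $ i) * ennreal (fejer N ((x::real^'n) $ i))) \<partial>lborel)"
    by presburger
  also have "\<dots> = (\<Prod>i\<in>(UNIV::'n set). \<integral>\<^sup>+t. indicator {-1/2..<1/2} t * ennreal (fejer N t) \<partial>lborel)"
    by (rule nn_integral_prod_cart) measurable
  finally show ?thesis
    unfolding nn_integral_fejer[OF assms] by simp
qed

text \<open>The integrand is a product over the coordinates. Only coordinate \<open>k\<close> is
  restricted to the tail; each of the others integrates to 1.\<close>

lemma nn_integral_fejer_kernel_tail1:
  assumes "N > 0" "d > 0"
  shows "(\<integral>\<^sup>+x. ennreal (indicator (unit_cell \<inter> {x. d \<le> \<bar>x $ k\<bar>}) x * fejer_kernel N (x::real^'n)) \<partial>lborel)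
    \<le> ennreal (1 / (real N * (sin (pi * d))\<^sup>2))"
proof -
  let ?f = "\<lambda>i t. indicator ({-1/2..<1/2} \<inter> (if i = k then {t. d \<le> \<bar>t\<bar>} else UNIV)) t * ennreal (fejer N t)"
  have "ennreal (indicator (unit_cell \<inter> {x. d \<le> \<bar>x $ k\<bar>}) x * fejer_kernel N x)
      = (\<Prod>i\<in>UNIV. ?f i (x $ i))" for x :: "real^'n"
  proof (cases "x \<in> unit_cell \<inter> {x. d \<le> \<bar>x $ k\<bar>}")
    case True
    then have "?f i (x $ i) = ennreal (fejer N (x $ i))" for i
      by (auto simp: unit_cell_def indicator_def)
    then show ?thesis
      using True by (simp add: fejer_kernel_def prod_ennreal fejer_nonneg)
  next
    case False
    then have "\<exists>i. ?f i (x $ i) = 0"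
      by (auto simp: unit_cell_def indicator_def)
    then show ?thesis
      using False by (simp add: prod_zero)
  qed
  moreover have "(\<integral>\<^sup>+x. (\<Prod>i\<in>UNIV. ?f i (x $ i)) \<partial>lborel) = (\<Prod>i\<in>UNIV. \<integral>\<^sup>+t. ?f i t \<partial>lborel)"
    by (rule nn_integral_prod_cart) measurable
  moreover have "(\<integral>\<^sup>+t. ?f i t \<partial>lborel) = 1" if "i \<noteq> k" for i
    using that nn_integral_fejer[OF assms(1)] by simp
  then have "(\<Prod>i\<in>UNIV. \<integral>\<^sup>+t. ?f i t \<partial>lborel) = (\<integral>\<^sup>+t. ?f k t \<partial>lborel)"
    by (subst prod.remove[of _ k]) auto
  ultimately show ?thesis
    using nn_integral_fejer_tail[of d N] assms by simp
qed

lemma has_bochner_integral_fejer_kernel: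
  assumes "N > 0"
  shows "has_bochner_integral lborel (\<lambda>x::real^'n. indicator unit_cell x * fejer_kernel N x) 1"
  using nn_integral_fejer_kernel[OF assms]
  by (intro has_bochner_integral_nn_integral) (auto simp: fejer_kernel_nonneg)

text \<open>A union bound over the coordinates, whence the factor \<open>CARD('n)\<close>.\<close>

lemma integral_fejer_kernel_tail:
  assumes "N > 0" "d > 0"
  shows "(LINT x|lborel. indicator (unit_cell \<inter> {x. \<exists>i. d \<le> \<bar>x $ i\<bar>}) x * fejer_kernel N (x::real^'n))
    \<le> real CARD('n) / (real N * (sin (pi * d))\<^sup>2)"
proof (rule integral_real_bounded)
  let ?C = "1 / (real N * (sin (pi * d))\<^sup>2)"
  have "(\<integral>\<^sup>+x. ennreal (indicator (unit_cell \<inter> {x. \<exists>i. d \<le> \<bar>x $ i\<bar>}) x * fejer_kernel N (x::real^'n)) \<partial>lborel)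
      \<le> (\<integral>\<^sup>+x. (\<Sum>i\<in>UNIV. ennreal (indicator (unit_cell \<inter> {x. d \<le> \<bar>x $ i\<bar>}) x * fejer_kernel N (x::real^'n))) \<partial>lborel)"
  proof (rule nn_integral_mono)
    fix x :: "real^'n"
    show "ennreal (indicator (unit_cell \<inter> {x. \<exists>i. d \<le> \<bar>x $ i\<bar>}) x * fejer_kernel N x)
      \<le> (\<Sum>i\<in>UNIV. ennreal (indicator (unit_cell \<inter> {x. d \<le> \<bar>x $ i\<bar>}) x * fejer_kernel N x))"
    proof (cases "x \<in> unit_cell \<inter> {x. \<exists>i. d \<le> \<bar>x $ i\<bar>}")
      case True
      then obtain i where i: "x \<in> unit_cell \<inter> {x. d \<le> \<bar>x $ i\<bar>}" by auto
      then have "ennreal (indicator (unit_cell \<inter> {x. \<exists>i. d \<le> \<bar>x $ i\<bar>}) x * fejer_kernel N x)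
          = ennreal (indicator (unit_cell \<inter> {x. d \<le> \<bar>x $ i\<bar>}) x * fejer_kernel N x)"
        using True by simp
      also have "\<dots> \<le> (\<Sum>i\<in>UNIV. ennreal (indicator (unit_cell \<inter> {x. d \<le> \<bar>x $ i\<bar>}) x * fejer_kernel N x))"
        by (rule member_le_sum) auto
      finally show ?thesis .
    qed simp
  qed
  also have "\<dots> = (\<Sum>i\<in>UNIV. \<integral>\<^sup>+x. ennreal (indicator (unit_cell \<inter> {x. d \<le> \<bar>x $ i\<bar>}) x * fejer_kernel N (x::real^'n)) \<partial>lborel)"
    by (rule nn_integral_sum) measurable
  also have "\<dots> \<le> (\<Sum>i\<in>(UNIV::'n set). ennreal ?C)"
    by (intro sum_mono nn_integral_fejer_kernel_tail1 assms)
  also have "\<dots> = ennreal (real CARD('n) / (real N * (sin (pi * d))\<^sup>2))"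
    by (simp add: ennreal_of_nat_eq_real_of_nat ennreal_mult[symmetric])
  finally show "(\<integral>\<^sup>+x. ennreal (indicator (unit_cell \<inter> {x. \<exists>i. d \<le> \<bar>x $ i\<bar>}) x * fejer_kernel N (x::real^'n)) \<partial>lborel)
      \<le> ennreal (real CARD('n) / (real N * (sin (pi * d))\<^sup>2))" .
qed simp

lemma integrable_bounded_fejer_kernel:
  fixes g :: "real ^ 'n \<Rightarrow> real"
  assumes [measurable]: "g \<in> borel_measurable borel" and "\<And>x. \<bar>g x\<bar> \<le> C" "N > 0"
  shows "integrable lborel (\<lambda>x. indicator unit_cell x * g x * fejer_kernel N x)"
proof (rule Bochner_Integration.integrable_bound)
  show "integrable lborel (\<lambda>x::real^'n. C * (indicator unit_cell x * fejer_kernel N x))"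
    using has_bochner_integral_fejer_kernel[OF assms(3), where 'n='n]
    by (intro integrable_mult_right) (simp add: has_bochner_integral_iff)
  show "AE x in lborel. norm (indicator unit_cell x * g x * fejer_kernel N x)
      \<le> norm (C * (indicator unit_cell x * fejer_kernel N x))"
    using assms(2) by (intro AE_I2) (auto simp: abs_mult indicator_def fejer_kernel_nonneg intro!: mult_right_mono
        order_trans[OF assms(2) abs_ge_self])
qed measurable

text \<open>Near 0 the deviation of \<open>g\<close> from \<open>g 0\<close> is at most e / 2 and
  the kernel has mass 1. Away from 0 the deviation is at most 2 C, and the mass of the kernel there
  is of order 1 / N.\<close>

lemma fejer_kernel_approximate_identity:
  fixes g :: "real ^ 'n \<Rightarrow> real"
  assumes [measurable]: "g \<in> borel_measurable borel" and bd: "\<And>x. \<bar>g x\<bar> \<le> C" and "isCont g 0"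
  shows "(\<lambda>N. LINT x|lborel. indicator unit_cell x * g x * fejer_kernel N x) \<longlonglongrightarrow> g 0"
proof (rule LIMSEQ_I)
  fix e :: real assume "e > 0"
  have C: "C \<ge> 0" using bd[of 0] by linarith
  obtain s where s: "s > 0" "\<And>x. norm x < s \<Longrightarrow> \<bar>g x - g 0\<bar> < e / 2"
    using \<open>isCont g 0\<close> \<open>e > 0\<close> unfolding continuous_at_eps_delta dist_norm
    by (metis diff_zero half_gt_zero real_norm_def)
  \<comment> \<open>The bound 1/2 keeps sin (pi d) positive. The other bound makes the sum of the
    absolute coordinates at most s / 2 when each of them is below \<open>d\<close>.\<close>
  define d where "d = min (1/2) (s / (2 * real CARD('n)))"
  have d: "d > 0" "d \<le> 1/2" using s by (auto simp: d_def)
  have small: "\<bar>g x - g 0\<bar> \<le> e / 2" if "\<not> (\<exists>i. d \<le> \<bar>x $ i\<bar>)" for x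
  proof -
    have "norm x \<le> (\<Sum>i\<in>UNIV. \<bar>x $ i\<bar>)" by (rule norm_le_l1_cart)
    also have "\<dots> \<le> (\<Sum>i\<in>(UNIV::'n set). s / (2 * real CARD('n)))"
      using that by (intro sum_mono) (auto simp: d_def not_le intro: less_imp_le)
    also have "\<dots> < s" using s by simp
    finally show ?thesis using s(2) by (auto intro: less_imp_le)
  qed
  let ?S = "(sin (pi * d))\<^sup>2"
  have S: "?S > 0"
    using d sin_gt_zero[of "pi * d"] by (auto simp: field_simps intro: le_less_trans[of _ "pi * (1/2)"])
  let ?T = "unit_cell \<inter> {x::real^'n. \<exists>i. d \<le> \<bar>x $ i\<bar>}"
  have [measurable]: "?T \<in> sets borel"
    by measurable
  have bound: "\<bar>(LINT x|lborel. indicator unit_cell x * g x * fejer_kernel N x) - g 0\<bar>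
      \<le> e / 2 + 2 * C * (real CARD('n) / (real N * ?S))" if "N > 0" for N
  proof -
    have K: "integrable lborel (\<lambda>x::real^'n. indicator unit_cell x * fejer_kernel N x)"
        "(LINT x::real^'n|lborel. indicator unit_cell x * fejer_kernel N x) = 1"
      using has_bochner_integral_fejer_kernel[OF that] unfolding has_bochner_integral_iff by auto
    have intT: "integrable lborel (\<lambda>x. indicator ?T x * fejer_kernel N x)"
      by (rule Bochner_Integration.integrable_bound[OF K(1)])
        (auto simp: indicator_def fejer_kernel_nonneg)
    have intg: "integrable lborel (\<lambda>x. indicator unit_cell x * g x * fejer_kernel N x)"
      by (rule integrable_bounded_fejer_kernel[OF assms(1) bd that])
    \<comment> \<open>As the kernel has mass 1, \<open>g 0\<close> is the integral of the constant
      \<open>g 0\<close> against it.\<close>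
    have "(LINT x|lborel. indicator unit_cell x * g x * fejer_kernel N x) - g 0
        = (LINT x|lborel. indicator unit_cell x * g x * fejer_kernel N x)
          - (LINT x::real^'n|lborel. g 0 * (indicator unit_cell x * fejer_kernel N x))"
      unfolding integral_mult_right_zero K(2) by simp
    also have "\<dots> = (LINT x|lborel. indicator unit_cell x * g x * fejer_kernel N x
          - g 0 * (indicator unit_cell x * fejer_kernel N x))"
      using K intg by (intro Bochner_Integration.integral_diff[symmetric] integrable_mult_right) auto
    finally have eq: "(LINT x|lborel. indicator unit_cell x * g x * fejer_kernel N x) - g 0 = \<dots>" .
    have "\<bar>\<dots>\<bar> \<le> (LINT x|lborel. e / 2 * (indicator unit_cell x * fejer_kernel N x)
          + 2 * C * (indicator ?T x * fejer_kernel N x))"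
    proof (rule order_trans[OF integral_abs_bound integral_mono])
      fix x :: "real^'n"
      have "\<bar>indicator unit_cell x * g x * fejer_kernel N x - g 0 * (indicator unit_cell x * fejer_kernel N x)\<bar>
          = \<bar>g x - g 0\<bar> * (indicator unit_cell x * fejer_kernel N x)"
        by (simp add: abs_mult fejer_kernel_nonneg indicator_def flip: left_diff_distrib)
      also have "\<dots> \<le> (e / 2 + 2 * C * indicator {x. \<exists>i. d \<le> \<bar>x $ i\<bar>} x) * (indicator unit_cell x * fejer_kernel N x)"
      proof (rule mult_right_mono)
        show "\<bar>g x - g 0\<bar> \<le> e / 2 + 2 * C * indicator {x. \<exists>i. d \<le> \<bar>x $ i\<bar>} x"
          using small[of x] bd[of x] bd[of 0] \<open>e > 0\<close> by (auto simp: indicator_def)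
      qed (simp add: fejer_kernel_nonneg)
      also have "\<dots> = e / 2 * (indicator unit_cell x * fejer_kernel N x)
          + 2 * C * (indicator ?T x * fejer_kernel N x)"
        by (auto simp: indicator_def algebra_simps)
      finally show "\<bar>indicator unit_cell x * g x * fejer_kernel N x - g 0 * (indicator unit_cell x * fejer_kernel N x)\<bar> \<le> \<dots>" .
    qed (use K intg intT in \<open>auto intro!: integrable_abs Bochner_Integration.integrable_diff Bochner_Integration.integrable_add integrable_mult_right\<close>)
    also have "\<dots> = e / 2 * 1 + 2 * C * (LINT x|lborel. indicator ?T x * fejer_kernel N x)"
      using K intT by (subst Bochner_Integration.integral_add) auto
    also have "\<dots> \<le> e / 2 + 2 * C * (real CARD('n) / (real N * ?S))"
      using integral_fejer_kernel_tail[OF that d(1), where 'n='n] C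
      by (intro add_mono mult_left_mono) auto
    finally show ?thesis unfolding eq .
  qed
  have "(\<lambda>N. 2 * C * (real CARD('n) / ?S) / real N) \<longlonglongrightarrow> 0"
    by (rule lim_const_over_n)
  then have "\<forall>\<^sub>F N in sequentially. 2 * C * (real CARD('n) / ?S) / real N < e / 2"
    using \<open>e > 0\<close> by (intro order_tendstoD) auto
  then obtain N0 where N0: "\<And>N. N \<ge> N0 \<Longrightarrow> 2 * C * (real CARD('n) / ?S) / real N < e / 2"
    by (auto simp: eventually_sequentially)
  show "\<exists>no. \<forall>N\<ge>no. norm ((LINT x|lborel. indicator unit_cell x * g x * fejer_kernel N x) - g 0) < e"
  proof (intro exI allI impI)
    fix N assume N: "N \<ge> max 1 N0"
    then have "2 * C * (real CARD('n) / (real N * ?S)) < e / 2"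
      using N0[of N] by (simp add: field_simps)
    then show "norm ((LINT x|lborel. indicator unit_cell x * g x * fejer_kernel N x) - g 0) < e"
      using bound[of N] N by simp
  qed
qed

section \<open>The volume of intersections of translates\<close>

lemma translate_eq_image: "translate S v = (+) v ` S"
  by (auto simp: translate_def add.commute)

lemma mem_translate_iff: "x \<in> translate S v \<longleftrightarrow> x - v \<in> S"
  by (force simp: translate_def image_iff algebra_simps)

lemma compact_translate: "compact S \<Longrightarrow> compact (translate S v)"
  unfolding translate_eq_image by (rule compact_translation)

lemma compact_difference_set: "compact A \<Longrightarrow> compact B \<Longrightarrow> compact (difference_set A B)"
  unfolding difference_set_def by (rule compact_differences)

lemma vol_cross_eq_0:
  assumes "x \<notin> difference_set A B"
  shows "vol (A \<inter> translate B x) = 0"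
proof -
  have "A \<inter> translate B x = {}"
    using assms by (force simp: mem_translate_iff difference_set_def)
  then show ?thesis by simp
qed

text \<open>By outer regularity the compact translate \<open>?W\<close> lies in an open
  \<open>U\<close> of only slightly larger volume. Compactness gives one radius \<open>d\<close> by
  which \<open>?W\<close> may move without leaving \<open>U\<close>, so nearby translates differ
  little from \<open>?W\<close> in volume, with or without intersecting with
  \<open>A\<close>.\<close>

lemma isCont_vol_cross:
  fixes A B :: "(real ^ 'n) set"
  assumes A: "compact A" and B: "compact B"
  shows "isCont (\<lambda>x. vol (A \<inter> translate B x)) x"
  unfolding continuous_at_eps_delta
proof (intro allI impI)
  fix e :: real assume "e > 0"
  let ?W = "translate B x"
  have W: "compact ?W" using B by (rule compact_translate)
  obtain U where U: "open U" "?W \<subseteq> U" "U - ?W \<in> lmeasurable" "emeasure lebesgue (U - ?W) < ennreal e"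
    using sets_lebesgue_outer_open[OF fmeasurableD[OF lmeasurable_compact[OF W]] \<open>e > 0\<close>] by blast
  have Ue: "vol (U - ?W) < e"
    using U(3,4) \<open>e > 0\<close> by (simp add: emeasure_eq_measure2 ennreal_less_iff)
  obtain d where d: "d > 0" "(\<Union>w\<in>?W. ball w d) \<subseteq> U"
    using compact_subset_open_imp_ball_epsilon_subset[OF W U(1,2)] by blast
  show "\<exists>d>0. \<forall>y. dist y x < d \<longrightarrow> dist (vol (A \<inter> translate B y)) (vol (A \<inter> ?W)) < e"
  proof (intro exI[of _ d] conjI allI impI)
    fix y assume y: "dist y x < d"
    let ?V = "translate B y"
    have V: "compact ?V" using B by (rule compact_translate)
    note meas = lmeasurable_compact[OF A] lmeasurable_compact[OF V] lmeasurable_compact[OF W]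
    have "?V \<subseteq> U"
    proof
      fix v assume "v \<in> ?V"
      then have "v - y + x \<in> ?W" by (simp add: mem_translate_iff)
      moreover have "v \<in> ball (v - y + x) d"
        using y by (simp add: dist_norm norm_minus_commute algebra_simps)
      ultimately show "v \<in> U" using d by blast
    qed
    then have VW: "vol (?V - ?W) < e"
      using Ue U(3) meas measure_mono_fmeasurable[of "?V - ?W" "U - ?W" lebesgue] by fastforce
    \<comment> \<open>Translates have equal volume, so \<open>?V - ?W\<close> and
      \<open>?W - ?V\<close> have equal volume too, and one bound serves both.\<close>
    have vol_eq: "vol ?V = vol ?W"
      by (simp add: translate_eq_image measure_translation)
    have diff: "vol (S - T) = vol S - vol (S \<inter> T)" if "S \<in> lmeasurable" "T \<in> lmeasurable" for S T :: "(real ^ 'n) set"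
      using that measurable_measure_Diff[of S lebesgue "S \<inter> T"]
      by (simp add: Diff_Int fmeasurable.Int fmeasurableD)
    have WV: "vol (?W - ?V) < e"
      using VW vol_eq diff[OF meas(2,3)] diff[OF meas(3,2)] by (simp add: Int_commute)
    have "vol (A \<inter> S) \<le> vol (A \<inter> T) + vol (S - T)"
      if "S \<in> lmeasurable" "T \<in> lmeasurable" for S T
    proof -
      have "vol (A \<inter> S) \<le> vol (A \<inter> T \<union> (S - T))"
        using that meas by (intro measure_mono_fmeasurable fmeasurable.Un fmeasurable.Int fmeasurable.Diff) (auto dest: fmeasurableD)
      also have "\<dots> \<le> vol (A \<inter> T) + vol (S - T)"
        using that meas by (intro measure_Un_le) (auto dest: fmeasurableD)
      finally show ?thesis .
    qed
    from this[of ?V ?W] this[of ?W ?V] show "dist (vol (A \<inter> ?V)) (vol (A \<inter> ?W)) < e"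
      using meas VW WV by (auto simp: dist_real_def)
  qed (fact d)
qed

text \<open>By continuity the set where the volume is nonzero is open. It is contained in
  \<open>difference_set A B\<close>, hence in its interior; boundary points therefore contribute
  nothing.\<close>

lemma vol_cross_eq_0_outside_interior:
  fixes A B :: "(real ^ 'n) set"
  assumes "compact A" "compact B" "x \<notin> interior (difference_set A B)"
  shows "vol (A \<inter> translate B x) = 0"
proof (rule ccontr)
  let ?f = "\<lambda>x. vol (A \<inter> translate B x)"
  assume "?f x \<noteq> 0"
  have "continuous_on UNIV ?f"
    using isCont_vol_cross[OF assms(1,2)] by (simp add: continuous_on_eq_continuous_at)
  then have "open (?f -` (- {0}))"
    by (rule open_vimage[rotated]) auto
  moreover have "?f -` (- {0}) \<subseteq> difference_set A B"
    using vol_cross_eq_0 by auto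
  ultimately have "?f -` (- {0}) \<subseteq> interior (difference_set A B)"
    by (intro interior_maximal)
  then show False using \<open>?f x \<noteq> 0\<close> assms(3) by auto
qed

text \<open>A compact set is Borel, so passing to the completed measure changes nothing. The Fubini
  and substitution arguments below work over \<open>lborel\<close>.\<close>

lemma fourier_lborel:
  assumes "compact S"
  shows "fourier (indicator S) \<xi> = (LINT x|lborel. indicator S x * cis (- 2 * pi * (x \<bullet> \<xi>)))"
proof -
  have [measurable]: "S \<in> sets borel" using assms by (rule borel_compact)
  have "exp (- 2 * of_real pi * \<i> * of_real (x \<bullet> \<xi>)) = cis (- 2 * pi * (x \<bullet> \<xi>))" for x
    by (simp add: cis_conv_exp mult_ac)
  then show ?thesis
    unfolding fourier_def by (simp add: integral_completion cis_conv_exp)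
qed

lemma integral_reflect:
  fixes h :: "'a::euclidean_space \<Rightarrow> 'b::{banach, second_countable_topology}"
  assumes [measurable]: "h \<in> borel_measurable borel"
  shows "(LINT x|lborel. h (y - x)) = (LINT x|lborel. h x)"
  by (subst (2) lborel_affine[of "-1" y]) (simp_all add: density_1 integral_distr)

text \<open>The volume at \<open>x\<close> is the integral over y of 1_A(y) 1_B(y - x), a
  correlation of the two indicators. Exchanging the integrals and substituting u = y - x separates
  the variables.\<close>

lemma fourier_vol_cross:
  fixes A B :: "(real ^ 'n) set"
  assumes "compact A" "compact B"
  shows "(LINT x|lborel. of_real (vol (A \<inter> translate B x)) * cis (- 2 * pi * (x \<bullet> \<xi>)))
    = fourier (indicator A) \<xi> * cnj (fourier (indicator B) \<xi>)"
proof -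
  have [measurable]: "A \<in> sets borel" "B \<in> sets borel"
    using assms by (auto intro: borel_compact)
  let ?e = "\<lambda>x. cis (- 2 * pi * (x \<bullet> \<xi>))"
  have [measurable]: "?e \<in> borel_measurable borel"
    unfolding cis_conv_exp by measurable
  let ?F = "\<lambda>x y. indicator A y * indicator B (y - x) * ?e x"
  let ?D = "difference_set A B"
  have D: "compact ?D" using assms by (rule compact_difference_set)
  then have [measurable]: "?D \<in> sets borel" by (rule borel_compact)
  \<comment> \<open>The integrand has modulus at most 1 and is supported in
    \<open>?D \<times> A\<close>, a product of compact sets.\<close>
  have int: "integrable (lborel \<Otimes>\<^sub>M lborel) (\<lambda>(x, y). ?F x y)"
  proof (rule Bochner_Integration.integrable_bound)
    have "emeasure (lborel \<Otimes>\<^sub>M lborel) (?D \<times> A) = emeasure lborel ?D * emeasure lborel A"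
      by (rule lborel.emeasure_pair_measure_Times) auto
    also have "\<dots> < \<infinity>"
      using emeasure_compact_finite[OF D] emeasure_compact_finite[OF assms(1)]
      by (simp add: ennreal_mult_less_top)
    finally show "integrable (lborel \<Otimes>\<^sub>M lborel) (indicat_real (?D \<times> A))"
      by (intro integrable_real_indicator) auto
    show "AE z in lborel \<Otimes>\<^sub>M lborel. norm (case z of (x, y) \<Rightarrow> ?F x y) \<le> norm (indicat_real (?D \<times> A) z)"
    proof (rule AE_I2, clarify)
      fix x y :: "real^'n"
      have "y \<in> A \<Longrightarrow> y - x \<in> B \<Longrightarrow> x \<in> ?D"
        unfolding difference_set_def by (intro CollectI exI[of _ y] exI[of _ "y - x"]) simp
      then show "norm (?F x y) \<le> norm (indicat_real (?D \<times> A) (x, y))"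
        by (auto simp: indicator_def norm_mult)
    qed
  qed measurable
  have "of_real (vol (A \<inter> translate B x)) * ?e x = (LINT y|lborel. ?F x y)" for x
  proof -
    have "(LINT y|lborel. ?F x y) = (LINT y|lborel. of_real (indicator (A \<inter> translate B x) y)) * ?e x"
      by (subst Bochner_Integration.integral_mult_left_zero[symmetric], rule Bochner_Integration.integral_cong)
        (auto simp: indicator_def mem_translate_iff)
    also have "(LINT y|lborel. of_real (indicator (A \<inter> translate B x) y)) = complex_of_real (vol (A \<inter> translate B x))"
    proof -
      have [measurable]: "translate B x \<in> sets borel"
        using assms(2) by (intro borel_compact compact_translate)
      show ?thesis by (simp add: measure_completion)
    qed
    finally show ?thesis by simp
  qed
  then have "(LINT x|lborel. of_real (vol (A \<inter> translate B x)) * ?e x) = (LINT x|lborel. LINT y|lborel. ?F x y)"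
    by presburger
  also have "\<dots> = (LINT y|lborel. LINT x|lborel. ?F x y)"
    using lborel_pair.Fubini_integral[OF int] by simp
  also have "\<dots> = (LINT y|lborel. indicator A y * ?e y * cnj (LINT u|lborel. indicator B u * ?e u))"
  proof (rule Bochner_Integration.integral_cong[OF refl])
    fix y :: "real^'n"
    \<comment> \<open>With x = y - u, the character at x is the one at y times the conjugate of the
      one at u; this is the origin of \<open>cnj\<close> in the result.\<close>
    let ?h = "\<lambda>u. indicator A y * indicator B u * ?e (y - u)"
    have "(LINT x|lborel. ?F x y) = (LINT x|lborel. ?h (y - x))"
      by simp
    also have "\<dots> = (LINT u|lborel. ?h u)"
      by (rule integral_reflect) (unfold cis_conv_exp, measurable)
    also have "\<dots> = (LINT u|lborel. indicator A y * ?e y * cnj (indicator B u * ?e u))"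
      by (rule Bochner_Integration.integral_cong)
        (auto simp: cis_cnj cis_mult inner_diff_left algebra_simps indicator_def)
    also have "\<dots> = indicator A y * ?e y * cnj (LINT u|lborel. indicator B u * ?e u)"
      by (simp del: complex_cnj_mult)
    finally show "(LINT x|lborel. ?F x y) = \<dots>" .
  qed
  also have "\<dots> = (LINT y|lborel. indicator A y * ?e y) * cnj (LINT u|lborel. indicator B u * ?e u)"
    by simp
  finally show ?thesis
    using assms by (simp add: fourier_lborel)
qed

section \<open>Poisson summation over the integer lattice\<close>

text \<open>Integer points are indexed by functions so that frequency boxes are finite products
  \<open>PiE\<close>, the index sets produced by expanding a product of sums.\<close>

definition int_vec :: "('n::finite \<Rightarrow> int) \<Rightarrow> real ^ 'n" where
  "int_vec h = (\<chi> i. of_int (h i))"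

lemma int_vec_nth [simp]: "int_vec h $ i = of_int (h i)"
  by (simp add: int_vec_def)

lemma inj_int_vec: "inj int_vec"
  by (auto simp: inj_def vec_eq_iff)

lemma finite_bounded_int_vec:
  assumes "bounded S"
  shows "finite {h. int_vec h \<in> S}"
proof -
  obtain R where R: "\<And>x. x \<in> S \<Longrightarrow> norm x \<le> R"
    using assms by (auto simp: bounded_iff)
  have "{h. int_vec h \<in> S} \<subseteq> PiE UNIV (\<lambda>_. {- \<lceil>R\<rceil>..\<lceil>R\<rceil>})"
  proof
    fix h assume "h \<in> {h. int_vec h \<in> S}"
    then have "\<bar>real_of_int (h i)\<bar> \<le> R" for i
      using R[of "int_vec h"] component_le_norm_cart[of "int_vec h" i] by simp
    then have "real_of_int \<bar>h i\<bar> \<le> of_int \<lceil>R\<rceil>" for i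
      by (metis le_of_int_ceiling of_int_abs order_trans)
    then have "\<bar>h i\<bar> \<le> \<lceil>R\<rceil>" for i
      by (simp only: of_int_le_iff)
    then show "h \<in> PiE UNIV (\<lambda>_. {- \<lceil>R\<rceil>..\<lceil>R\<rceil>})"
      by (auto simp: PiE_iff abs_le_iff minus_le_iff)
  qed
  then show ?thesis
    by (rule finite_subset) (intro finite_PiE, auto)
qed

definition kernel_weight :: "nat \<Rightarrow> ('n::finite \<Rightarrow> int) \<Rightarrow> real" where
  "kernel_weight N h = (\<Prod>i\<in>UNIV. fejer_weight N (h i))"

lemma kernel_weight_bounds: "0 \<le> kernel_weight N h" "kernel_weight N h \<le> 1"
  by (auto simp: kernel_weight_def fejer_weight_bounds intro: prod_nonneg prod_le_1)

lemma kernel_weight_tendsto: "(\<lambda>N. kernel_weight N h) \<longlonglongrightarrow> 1"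
  using tendsto_prod[of UNIV "\<lambda>i N. fejer_weight N (h i)" "\<lambda>_. 1" sequentially]
  by (simp add: kernel_weight_def fejer_weight_tendsto)

abbreviation kernel_support :: "nat \<Rightarrow> ('n::finite \<Rightarrow> int) set" where
  "kernel_support N \<equiv> PiE UNIV (\<lambda>_. {- int N..int N})"

lemma finite_kernel_support: "finite (kernel_support N)"
  by (intro finite_PiE) auto

lemma kernel_weight_eq_0: "h \<notin> kernel_support N \<Longrightarrow> kernel_weight N h = 0"
  by (force simp: kernel_weight_def fejer_weight_def PiE_iff abs_le_iff minus_le_iff intro: prod_zero)

text \<open>Multiplying out the one-dimensional expansions gives one term for each choice of a
  frequency in every coordinate, and the characters combine into one in the inner product.\<close>

lemma fejer_kernel_expansion:
  fixes x :: "real ^ 'n"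
  assumes "N > 0"
  shows "complex_of_real (fejer_kernel N x)
    = (\<Sum>h\<in>kernel_support N. of_real (kernel_weight N h) * cis (- 2 * pi * (x \<bullet> int_vec h)))"
proof -
  let ?e = "\<lambda>(m::int) t. cis (- 2 * pi * of_int m * t)"
  have "complex_of_real (fejer_kernel N x)
      = (\<Prod>i\<in>UNIV. \<Sum>m\<in>{- int N..int N}. of_real (fejer_weight N m) * ?e m (x $ i))"
    unfolding fejer_kernel_def of_real_prod fejer_expansion[OF assms]
    by (intro prod.cong sum.cong) (auto simp: fejer_weight_def)
  also have "\<dots> = (\<Sum>h\<in>kernel_support N. \<Prod>i\<in>UNIV. of_real (fejer_weight N (h i)) * ?e (h i) (x $ i))"
    by (rule prod_sum_PiE) auto
  also have "\<dots> = (\<Sum>h\<in>kernel_support N. of_real (kernel_weight N h) * cis (- 2 * pi * (x \<bullet> int_vec h)))"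
  proof (intro sum.cong refl)
    fix h :: "'n \<Rightarrow> int"
    have "(\<Prod>i\<in>UNIV. ?e (h i) (x $ i)) = exp (\<Sum>i\<in>UNIV. \<i> * of_real (- 2 * pi * of_int (h i) * x $ i))"
      by (simp add: exp_sum cis_conv_exp)
    also have "(\<Sum>i\<in>UNIV. \<i> * of_real (- 2 * pi * of_int (h i) * x $ i))
        = \<i> * of_real (- 2 * pi * (x \<bullet> int_vec h))"
      by (simp add: inner_vec_def sum_distrib_left mult_ac flip: sum_negf)
    finally show "(\<Prod>i\<in>UNIV. of_real (fejer_weight N (h i)) * ?e (h i) (x $ i))
        = of_real (kernel_weight N h) * cis (- 2 * pi * (x \<bullet> int_vec h))"
      by (simp add: prod.distrib kernel_weight_def cis_conv_exp)
  qed
  finally show ?thesis .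
qed

text \<open>An absolutely convergent sum is an integral over \<open>count_space\<close>. Dominated
  convergence applies there with majorant \<open>norm (c h)\<close>, since the weights lie in
  [0, 1].\<close>

lemma weighted_sum_tendsto_infsum:
  fixes c :: "'a \<Rightarrow> complex" and w :: "nat \<Rightarrow> 'a \<Rightarrow> real"
  assumes c: "(\<lambda>h. norm (c h)) summable_on UNIV"
    and w: "\<And>N h. 0 \<le> w N h" "\<And>N h. w N h \<le> 1" "\<And>h. (\<lambda>N. w N h) \<longlonglongrightarrow> 1"
    and H: "\<And>N. finite (H N)" "\<And>N h. h \<notin> H N \<Longrightarrow> w N h = 0"
  shows "(\<lambda>N. \<Sum>h\<in>H N. of_real (w N h) * c h) \<longlonglongrightarrow> infsum c UNIV"
proof -
  have ic: "integrable (count_space UNIV) c"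
    using c unfolding abs_summable_equivalent abs_summable_on_def .
  have le: "norm (of_real (w N h) * c h) \<le> norm (c h)" for N h
    using w(1,2)[of N h] by (auto simp: norm_mult intro: mult_left_le_one_le)
  have "(\<lambda>N. LINT h|count_space UNIV. of_real (w N h) * c h) \<longlonglongrightarrow> (LINT h|count_space UNIV. c h)"
  proof (rule integral_dominated_convergence[where w="\<lambda>h. norm (c h)"])
    show "AE h in count_space UNIV. (\<lambda>N. of_real (w N h) * c h) \<longlonglongrightarrow> c h"
    proof (rule AE_I2)
      fix h
      have "(\<lambda>N. complex_of_real (w N h) * c h) \<longlonglongrightarrow> of_real 1 * c h"
        by (intro tendsto_intros w)
      then show "(\<lambda>N. of_real (w N h) * c h) \<longlonglongrightarrow> c h" by simp
    qed
  qed (use ic le in auto)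
  moreover have "(LINT h|count_space UNIV. c h) = infsum c UNIV"
    using infsetsum_infsum[of c UNIV] ic by (simp add: infsetsum_def abs_summable_on_def)
  moreover have "(LINT h|count_space UNIV. of_real (w N h) * c h) = (\<Sum>h\<in>H N. of_real (w N h) * c h)" for N
  proof -
    have "integrable (count_space UNIV) (\<lambda>h. of_real (w N h) * c h)"
      using le by (intro Bochner_Integration.integrable_bound[OF ic]) auto
    then have "(LINT h|count_space UNIV. of_real (w N h) * c h) = infsum (\<lambda>h. of_real (w N h) * c h) UNIV"
      using infsetsum_infsum[of "\<lambda>h. of_real (w N h) * c h" UNIV] by (simp add: infsetsum_def abs_summable_on_def)
    also have "\<dots> = infsum (\<lambda>h. of_real (w N h) * c h) (H N)"
      by (rule infsum_cong_neutral) (auto simp: H(2))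
    finally show ?thesis using H(1) by simp
  qed
  ultimately show ?thesis by simp
qed

section \<open>Integer translates of the unit cell and sampling by the periodic kernel\<close>

lemma
  fixes h :: "'a::euclidean_space \<Rightarrow> 'b::{banach, second_countable_topology}"
  shows integrable_shift: "integrable lborel h \<Longrightarrow> integrable lborel (\<lambda>x. h (x + a))"
    and integral_shift: "h \<in> borel_measurable borel \<Longrightarrow> (LINT x|lborel. h (x + a)) = (LINT x|lborel. h x)"
proof -
  have D: "distr lborel borel (\<lambda>x::'a. x + a) = lborel"
    using lborel_distr_plus[of a] by (simp add: add.commute[of a] cong: distr_cong)
  show "integrable lborel (\<lambda>x. h (x + a))" if "integrable lborel h"
    using that by (subst (asm) D[symmetric], subst (asm) integrable_distr_eq) (auto dest: borel_measurable_integrable)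
  show "(LINT x|lborel. h (x + a)) = (LINT x|lborel. h x)" if "h \<in> borel_measurable borel"
    using that by (subst (2) D[symmetric]) (simp add: integral_distr)
qed

text \<open>This is the partition property of the cells: each point lies in exactly one of them,
  found by rounding every coordinate to the nearest integer, ties upwards.\<close>

lemma mem_unit_cell_shift_iff:
  "x - int_vec h \<in> unit_cell \<longleftrightarrow> h = (\<lambda>i. \<lfloor>x $ i + 1/2\<rfloor>)"
proof -
  have "x $ i - of_int (h i) \<in> {-1/2..<1/2} \<longleftrightarrow> h i = \<lfloor>x $ i + 1/2\<rfloor>" for i
    using floor_eq_iff[of "x $ i + 1/2" "h i"] by (auto simp: algebra_simps)
  then show ?thesis
    by (simp add: unit_cell_def fun_eq_iff)
qed

lemma bounded_unit_cell: "bounded (unit_cell :: (real ^ 'n) set)"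
  by (rule bounded_subset[OF bounded_cbox[of "\<chi> i. -1/2" "\<chi> i. 1/2"]])
    (auto simp: unit_cell_def mem_box_cart less_imp_le)

text \<open>As \<open>f\<close> vanishes off the bounded set \<open>D\<close>, finitely many cells
  carry the whole integral, and the limit can be taken in each cell separately.\<close>

lemma fejer_kernel_sampling:
  fixes f :: "real ^ 'n \<Rightarrow> real"
  assumes cont: "\<And>x. isCont f x" and bd: "\<And>x. \<bar>f x\<bar> \<le> C"
    and D: "bounded D" "\<And>x. x \<notin> D \<Longrightarrow> f x = 0"
  shows "(\<lambda>N. LINT x|lborel. f x * fejer_kernel N x) \<longlonglongrightarrow> (\<Sum>h | int_vec h \<in> D. f (int_vec h))"
proof -
  have [measurable]: "f \<in> borel_measurable borel"
    using cont by (intro borel_measurable_continuous_onI) (simp add: continuous_on_eq_continuous_at)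
  \<comment> \<open>Two kinds of indices: the integer points of \<open>D\<close>, over which the
    limit is summed, and those whose cell meets \<open>D\<close>, needed to recover the integral.
    Such an index is a point of \<open>D\<close> minus a point of the unit cell.\<close>
  define Z where "Z = {h. int_vec h \<in> D \<union> (\<lambda>(x, y). x - y) ` (D \<times> unit_cell)}"
  have finZ: "finite Z"
    unfolding Z_def using D(1) bounded_unit_cell
    by (intro finite_bounded_int_vec bounded_Un[THEN iffD2] conjI bounded_minus)
  have "(\<lambda>N. \<Sum>h\<in>Z. LINT x|lborel. indicator unit_cell x * f (x + int_vec h) * fejer_kernel N x)
      \<longlonglongrightarrow> (\<Sum>h\<in>Z. f (0 + int_vec h))"
  proof (intro tendsto_sum fejer_kernel_approximate_identity)
    fix h :: "'n \<Rightarrow> int"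
    show "isCont (\<lambda>x. f (x + int_vec h)) 0"
      by (rule isCont_o2[where g=f]) (auto intro: cont continuous_intros)
    show "\<bar>f (x + int_vec h)\<bar> \<le> C" for x by (rule bd)
  qed measurable
  moreover have "(\<Sum>h\<in>Z. f (0 + int_vec h)) = (\<Sum>h | int_vec h \<in> D. f (int_vec h))"
    using finZ D(2) by (simp, intro sum.mono_neutral_right) (auto simp: Z_def)
  moreover have "\<forall>\<^sub>F N in sequentially.
      (\<Sum>h\<in>Z. LINT x|lborel. indicator unit_cell x * f (x + int_vec h) * fejer_kernel N x)
      = (LINT x|lborel. f x * fejer_kernel N x)"
    using eventually_gt_at_top[of 0]
  proof eventually_elim
    case (elim N)
    let ?g = "\<lambda>h x. indicator unit_cell x * f (x + int_vec h) * fejer_kernel N x"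
    \<comment> \<open>The integrand over cell \<open>h\<close> moved back to its place in space;
      periodicity leaves the kernel unchanged.\<close>
    let ?g' = "\<lambda>h x. indicator unit_cell (x - int_vec h) * f x * fejer_kernel N x"
    have shift: "fejer_kernel N (x - int_vec h) = fejer_kernel N x" for h and x :: "real ^ 'n"
      using fejer_kernel_periodic[of N "x - int_vec h" h] by (simp flip: int_vec_def)
    have int: "integrable lborel (?g h)" for h
      using elim bd by (intro integrable_bounded_fejer_kernel[of _ C]) measurable
    have int': "integrable lborel (?g' h)" for h
      using integrable_shift[OF int[of h], of "- int_vec h"] by (simp add: shift flip: diff_conv_add_uminus)
    have "(LINT x|lborel. ?g h x) = (LINT x|lborel. ?g' h x)" for h
      using integral_shift[of "?g h" "- int_vec h"] by (simp add: shift flip: diff_conv_add_uminus)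
    then have "(\<Sum>h\<in>Z. LINT x|lborel. ?g h x) = (\<Sum>h\<in>Z. LINT x|lborel. ?g' h x)"
      by simp
    also have "\<dots> = (LINT x|lborel. (\<Sum>h\<in>Z. ?g' h x))"
      using int' by (intro Bochner_Integration.integral_sum[symmetric]) auto
    also have "\<dots> = (LINT x|lborel. f x * fejer_kernel N x)"
    proof (rule Bochner_Integration.integral_cong[OF refl])
      fix x :: "real^'n"
      let ?k = "\<lambda>i. \<lfloor>x $ i + 1/2\<rfloor>"
      show "(\<Sum>h\<in>Z. ?g' h x) = f x * fejer_kernel N x"
      proof (cases "x \<in> D")
        case True
        have cell: "x - int_vec ?k \<in> unit_cell"
          by (simp add: mem_unit_cell_shift_iff)
        then have "int_vec ?k \<in> (\<lambda>(x, y). x - y) ` (D \<times> unit_cell)"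
          using True by (intro image_eqI[of _ _ "(x, x - int_vec ?k)"]) simp_all
        then have "?k \<in> Z"
          unfolding Z_def by blast
        then have "(\<Sum>h\<in>Z. ?g' h x) = (\<Sum>h\<in>{?k}. ?g' h x)"
          by (intro sum.mono_neutral_right finZ) (auto simp: indicator_def mem_unit_cell_shift_iff)
        then show ?thesis using cell by simp
      qed (simp add: D(2))
    qed
    finally show ?case .
  qed
  ultimately show ?thesis
    by (simp add: tendsto_cong)
qed

text \<open>After expanding the kernel, each frequency contributes a value of the transform of the
  intersection volume, which \<open>fourier_vol_cross\<close> factors. Only finitely many
  frequencies occur, so integrability of each term is enough.\<close>

lemma integral_vol_cross_kernel:
  fixes A B :: "(real ^ 'n) set"
  assumes A: "compact A" and B: "compact B" and "N > 0"
  shows "complex_of_real (LINT x|lborel. vol (A \<inter> translate B x) * fejer_kernel N x)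
    = (\<Sum>h\<in>kernel_support N. of_real (kernel_weight N h) *
        (fourier (indicator A) (int_vec h) * cnj (fourier (indicator B) (int_vec h))))"
proof -
  let ?f = "\<lambda>x. vol (A \<inter> translate B x)"
  let ?D = "difference_set A B"
  have D: "compact ?D" using A B by (rule compact_difference_set)
  have [measurable]: "?f \<in> borel_measurable borel"
    using isCont_vol_cross[OF A B]
    by (intro borel_measurable_continuous_onI) (simp add: continuous_on_eq_continuous_at)
  have bound: "?f x \<le> vol A * indicator ?D x" for x
  proof (cases "x \<in> ?D")
    case True
    then show ?thesis
      using A compact_translate[OF B, of x]
      by (auto intro!: measure_mono_fmeasurable lmeasurable_compact fmeasurableD)
  qed (simp add: vol_cross_eq_0)
  have int: "integrable lborel (\<lambda>x. of_real (?f x) * cis (- 2 * pi * (x \<bullet> \<xi>)))" for \<xi>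
  proof (rule Bochner_Integration.integrable_bound)
    show "integrable lborel (\<lambda>x. vol A * indicat_real ?D x)"
      using emeasure_compact_finite[OF D] D
      by (intro integrable_mult_right integrable_real_indicator) (auto intro: borel_compact)
    show "AE x in lborel. norm (of_real (?f x) * cis (- 2 * pi * (x \<bullet> \<xi>))) \<le> norm (vol A * indicat_real ?D x)"
      using bound by (intro AE_I2) (auto simp: norm_mult intro: order_trans[OF bound abs_ge_self])
  qed (unfold cis_conv_exp, measurable)
  have "complex_of_real (LINT x|lborel. ?f x * fejer_kernel N x)
      = (LINT x|lborel. of_real (?f x * fejer_kernel N x))"
    by (rule integral_complex_of_real[symmetric])
  also have "\<dots> = (LINT x|lborel. (\<Sum>h\<in>kernel_support N. of_real (kernel_weight N h) *
      (of_real (?f x) * cis (- 2 * pi * (x \<bullet> int_vec h)))))"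
    by (rule Bochner_Integration.integral_cong)
      (auto simp: fejer_kernel_expansion[OF \<open>N > 0\<close>] sum_distrib_left mult_ac)
  also have "\<dots> = (\<Sum>h\<in>kernel_support N. (LINT x|lborel. of_real (kernel_weight N h) *
      (of_real (?f x) * cis (- 2 * pi * (x \<bullet> int_vec h)))))"
    using int by (intro Bochner_Integration.integral_sum integrable_mult_right) auto
  also have "\<dots> = (\<Sum>h\<in>kernel_support N. of_real (kernel_weight N h) *
        (fourier (indicator A) (int_vec h) * cnj (fourier (indicator B) (int_vec h))))"
    unfolding integral_mult_right_zero fourier_vol_cross[OF A B] ..
  finally show ?thesis .
qed

text \<open>Sampling is applied with the interior of \<open>difference_set A B\<close> as the
  bounded set off which the function vanishes, so the interior becomes the index set of the
  limit.\<close>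

lemma integral_vol_cross_kernel_tendsto:
  fixes A B :: "(real ^ 'n) set"
  assumes A: "compact A" and B: "compact B"
  shows "(\<lambda>N. LINT x|lborel. vol (A \<inter> translate B x) * fejer_kernel N x)
    \<longlonglongrightarrow> (\<Sum>h | int_vec h \<in> interior (difference_set A B). vol (A \<inter> translate B (int_vec h)))"
proof (rule fejer_kernel_sampling)
  show "isCont (\<lambda>x. vol (A \<inter> translate B x)) x" for x
    by (rule isCont_vol_cross[OF A B])
  show "\<bar>vol (A \<inter> translate B x)\<bar> \<le> vol A" for x
    using A compact_translate[OF B, of x]
    by (auto intro!: measure_mono_fmeasurable lmeasurable_compact fmeasurableD)
  show "bounded (interior (difference_set A B))"
    by (intro bounded_interior compact_imp_bounded compact_difference_set A B)
  show "vol (A \<inter> translate B x) = 0" if "x \<notin> interior (difference_set A B)" for x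
    using vol_cross_eq_0_outside_interior[OF A B that] .
qed

text \<open>For a finite \<open>F\<close> the weighted sum over \<open>F\<close> is at most the full
  weighted sum, all terms being nonnegative. Letting \<open>N\<close> grow removes the weights on
  \<open>F\<close> and leaves the bound \<open>?S\<close>, which does not depend on
  \<open>F\<close>.\<close>

lemma fourier_square_summable:
  fixes A :: "(real ^ 'n) set"
  assumes A: "compact A"
  shows "(\<lambda>h. (cmod (fourier (indicator A) (int_vec h)))\<^sup>2) summable_on UNIV"
proof (rule nonneg_bdd_above_summable_on)
  let ?c = "\<lambda>h. (cmod (fourier (indicator A) (int_vec h)))\<^sup>2"
  let ?S = "\<Sum>h | int_vec h \<in> interior (difference_set A A). vol (A \<inter> translate A (int_vec h))"
  \<comment> \<open>With both sets equal the products are squared moduli, so the identity descends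
    to the reals, where it can be used in estimates.\<close>
  have eq: "(LINT x|lborel. vol (A \<inter> translate A x) * fejer_kernel N x)
      = (\<Sum>h\<in>kernel_support N. kernel_weight N h * ?c h)" if "N > 0" for N
    using integral_vol_cross_kernel[OF A A that]
    by (simp add: complex_norm_square[symmetric] flip: of_real_mult of_real_sum of_real_power)
  show "bdd_above (sum ?c ` {F. F \<subseteq> UNIV \<and> finite F})"
  proof (rule bdd_aboveI2)
    fix F :: "('n \<Rightarrow> int) set" assume "F \<in> {F. F \<subseteq> UNIV \<and> finite F}"
    then have F: "finite F" by simp
    show "sum ?c F \<le> ?S"
    proof (rule LIMSEQ_le)
      show "(\<lambda>N. LINT x|lborel. vol (A \<inter> translate A x) * fejer_kernel N x) \<longlonglongrightarrow> ?S"
        by (rule integral_vol_cross_kernel_tendsto[OF A A])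
      have "(\<lambda>N. \<Sum>h\<in>F. kernel_weight N h * ?c h) \<longlonglongrightarrow> (\<Sum>h\<in>F. 1 * ?c h)"
        by (intro tendsto_sum tendsto_mult kernel_weight_tendsto tendsto_const)
      then show "(\<lambda>N. \<Sum>h\<in>F. kernel_weight N h * ?c h) \<longlonglongrightarrow> sum ?c F" by simp
      have "(\<Sum>h\<in>F. kernel_weight N h * ?c h) \<le> (LINT x|lborel. vol (A \<inter> translate A x) * fejer_kernel N x)"
        if "N \<ge> 1" for N
      proof -
        have "(\<Sum>h\<in>F. kernel_weight N h * ?c h) = (\<Sum>h\<in>F \<inter> kernel_support N. kernel_weight N h * ?c h)"
          using F by (intro sum.mono_neutral_right) (auto simp: kernel_weight_eq_0)
        also have "\<dots> \<le> (\<Sum>h\<in>kernel_support N. kernel_weight N h * ?c h)"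
          by (intro sum_mono2 finite_kernel_support) (auto simp: kernel_weight_bounds)
        finally show ?thesis using that eq[of N] by simp
      qed
      then show "\<exists>N. \<forall>n\<ge>N. (\<Sum>h\<in>F. kernel_weight n h * ?c h)
          \<le> (LINT x|lborel. vol (A \<inter> translate A x) * fejer_kernel n x)" by blast
    qed
  qed
qed simp

lemma fourier_product_abs_summable:
  fixes A B :: "(real ^ 'n) set"
  assumes "compact A" "compact B"
  shows "(\<lambda>h. norm (fourier (indicator A) (int_vec h) * cnj (fourier (indicator B) (int_vec h)))) summable_on UNIV"
proof (rule Infinite_Sum.abs_summable_on_comparison_test')
  show "(\<lambda>h. (cmod (fourier (indicator A) (int_vec h)))\<^sup>2 + (cmod (fourier (indicator B) (int_vec h)))\<^sup>2) summable_on UNIV"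
    by (intro summable_on_add fourier_square_summable assms)
  have "a * b \<le> a\<^sup>2 + b\<^sup>2" if "0 \<le> a" "0 \<le> b" for a b :: real
    using sum_squares_bound[of a b] mult_nonneg_nonneg[OF that] by linarith
  then show "norm (fourier (indicator A) (int_vec h) * cnj (fourier (indicator B) (int_vec h)))
      \<le> (cmod (fourier (indicator A) (int_vec h)))\<^sup>2 + (cmod (fourier (indicator B) (int_vec h)))\<^sup>2" for h
    by (simp add: norm_mult)
qed

lemma poisson_int_lattice:
  fixes A B :: "(real ^ 'n) set"
  assumes A: "compact A" and B: "compact B"
  shows "complex_of_real (\<Sum>h | int_vec h \<in> interior (difference_set A B). vol (A \<inter> translate B (int_vec h)))
    = (\<Sum>\<^sub>\<infinity>h. fourier (indicator A) (int_vec h) * cnj (fourier (indicator B) (int_vec h)))"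
    (is "_ = infsum ?c UNIV")
proof (rule LIMSEQ_unique)
  let ?I = "\<lambda>N. complex_of_real (LINT x|lborel. vol (A \<inter> translate B x) * fejer_kernel N x)"
  show "?I \<longlonglongrightarrow> complex_of_real (\<Sum>h | int_vec h \<in> interior (difference_set A B). vol (A \<inter> translate B (int_vec h)))"
    by (intro tendsto_of_real integral_vol_cross_kernel_tendsto A B)
  have "(\<lambda>N. \<Sum>h\<in>kernel_support N. of_real (kernel_weight N h) * ?c h) \<longlonglongrightarrow> infsum ?c UNIV"
    by (intro weighted_sum_tendsto_infsum fourier_product_abs_summable A B kernel_weight_bounds
        kernel_weight_tendsto finite_kernel_support kernel_weight_eq_0)
  moreover have "\<forall>\<^sub>F N in sequentially. (\<Sum>h\<in>kernel_support N. of_real (kernel_weight N h) * ?c h) = ?I N"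
    using eventually_gt_at_top[of 0]
    by eventually_elim (simp add: integral_vol_cross_kernel[OF A B])
  ultimately show "?I \<longlonglongrightarrow> infsum ?c UNIV"
    by (simp add: tendsto_cong)
qed

section \<open>General lattices\<close>

text \<open>This rule would turn \<open>transpose M *v x\<close> into \<open>x v* M\<close>, whereas
  transposes below act from the left like any other matrix.\<close>

declare transpose_matrix_vector [simp del]

section \<open>Volumes, transforms and dual lattices under a linear map\<close>

lemma compact_matrix_image: "compact S \<Longrightarrow> compact ((*v) M ` S)" for M :: "real ^ 'n ^ 'n"
  by (intro compact_continuous_image continuous_intros)

lemma matrix_inv_mult:
  fixes M :: "real ^ 'n ^ 'n"
  assumes "invertible M"
  shows "M ** matrix_inv M = mat 1" "matrix_inv M ** M = mat 1"
  using someI_ex[OF assms[unfolded invertible_def]] by (auto simp: matrix_inv_def)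

lemma matrix_inv_vector_mult:
  fixes M :: "real ^ 'n ^ 'n"
  assumes "invertible M"
  shows "M *v (matrix_inv M *v x) = x" "matrix_inv M *v (M *v x) = x"
  by (simp_all add: matrix_vector_mul_assoc matrix_inv_mult[OF assms])

lemma inj_matrix_vector_mult: "invertible M \<Longrightarrow> inj ((*v) M)" for M :: "real ^ 'n ^ 'n"
  by (metis injI matrix_inv_vector_mult(2))

lemma vol_matrix_image:
  fixes M :: "real ^ 'n ^ 'n"
  assumes M: "invertible M" and S: "compact S"
  shows "vol ((*v) M ` S) = \<bar>det M\<bar> * vol S"
proof -
  have [measurable]: "S \<in> sets borel" "(*v) M ` S \<in> sets borel"
    using S by (auto intro!: borel_compact compact_matrix_image)
  have "vol ((*v) M ` S) = (LINT x|lborel. indicat_real ((*v) M ` S) x)"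
    by (simp add: measure_completion)
  also have "\<dots> = \<bar>det M\<bar> *\<^sub>R (LINT x|lborel. indicat_real ((*v) M ` S) (M *v x))"
    by (rule integral_linear_cart[OF M]) measurable
  also have "(\<lambda>x. indicat_real ((*v) M ` S) (M *v x)) = indicat_real S"
    using inj_matrix_vector_mult[OF M] by (auto simp: indicator_def inj_image_mem_iff fun_eq_iff)
  finally show ?thesis by (simp add: measure_completion)
qed

text \<open>Substitution gives the determinant, and moving \<open>M\<close> across the inner product
  gives the transpose.\<close>

lemma fourier_matrix_image:
  fixes M :: "real ^ 'n ^ 'n"
  assumes M: "invertible M" and S: "compact S"
  shows "fourier (indicator ((*v) M ` S)) \<xi> = of_real \<bar>det M\<bar> * fourier (indicator S) (transpose M *v \<xi>)"
proof -
  have MS: "compact ((*v) M ` S)" using S by (rule compact_matrix_image)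
  have [measurable]: "S \<in> sets borel" "(*v) M ` S \<in> sets borel"
    using S MS by (auto intro: borel_compact)
  have inner: "(M *v x) \<bullet> \<xi> = x \<bullet> (transpose M *v \<xi>)" for x
    by (metis dot_lmul_matrix inner_commute transpose_matrix_vector)
  have "fourier (indicator ((*v) M ` S)) \<xi>
      = (LINT x|lborel. indicator ((*v) M ` S) x * cis (- 2 * pi * (x \<bullet> \<xi>)))"
    by (rule fourier_lborel[OF MS])
  also have "\<dots> = \<bar>det M\<bar> *\<^sub>R (LINT x|lborel. indicator ((*v) M ` S) (M *v x) * cis (- 2 * pi * ((M *v x) \<bullet> \<xi>)))"
    by (rule integral_linear_cart[OF M]) (unfold cis_conv_exp, measurable)
  also have "(\<lambda>x. indicator ((*v) M ` S) (M *v x) * cis (- 2 * pi * ((M *v x) \<bullet> \<xi>)))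
      = (\<lambda>x. indicator S x * cis (- 2 * pi * (x \<bullet> (transpose M *v \<xi>))))"
    using inj_matrix_vector_mult[OF M] by (auto simp: indicator_def inj_image_mem_iff fun_eq_iff inner)
  finally show ?thesis
    by (simp add: fourier_lborel[OF S] scaleR_conv_of_real)
qed

text \<open>The zero frequency is thereby the source of the term vol A vol B.\<close>

lemma fourier_at_0: "compact S \<Longrightarrow> fourier (indicator S) 0 = of_real (vol S)"
proof -
  assume S: "compact S"
  then have [measurable]: "S \<in> sets borel" by (rule borel_compact)
  have "fourier (indicator S) 0 = (LINT x|lborel. of_real (indicat_real S x))"
    unfolding fourier_lborel[OF S] by (rule Bochner_Integration.integral_cong) (auto simp: indicator_def)
  then show ?thesis by (simp add: measure_completion)
qed

lemma lattice_of_eq: "lattice_of M = (\<lambda>h. M *v int_vec h) ` UNIV"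
proof -
  have "\<exists>h. z = int_vec h" if "\<forall>i. z $ i \<in> \<int>" for z :: "real ^ 'n"
    using that by (intro exI[of _ "\<lambda>i. \<lfloor>z $ i\<rfloor>"]) (auto simp: vec_eq_iff floor_of_int elim: Ints_cases)
  then show ?thesis
    by (force simp: lattice_of_def)
qed

text \<open>The coordinates of \<open>transpose M *v \<xi>\<close> are the inner products of
  \<open>\<xi>\<close> with the columns of \<open>M\<close>, that is, with a lattice basis. They are
  all integers exactly when \<open>\<xi>\<close> is in the dual lattice.\<close>

lemma dual_lattice_of:
  fixes M :: "real ^ 'n ^ 'n"
  assumes M: "invertible M"
  shows "dual_lattice (lattice_of M) = lattice_of (matrix_inv (transpose M))"
proof -
  let ?T = "transpose M"
  have T: "invertible ?T" using M by (rule transpose_invertible)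
  have inner: "\<xi> \<bullet> (M *v x) = (?T *v \<xi>) \<bullet> x" for x \<xi>
    by (metis dot_lmul_matrix transpose_matrix_vector)
  have inv: "?T *v (matrix_inv ?T *v x) = x" "matrix_inv ?T *v (?T *v x) = x" for x
    by (fact matrix_inv_vector_mult[OF T])+
  show ?thesis
  proof (intro equalityI subsetI)
    fix \<xi> assume \<xi>: "\<xi> \<in> dual_lattice (lattice_of M)"
    have "(?T *v \<xi>) $ i \<in> \<int>" for i
    proof -
      have "M *v axis i 1 \<in> lattice_of M"
        unfolding lattice_of_def by (auto simp: axis_def intro!: exI[of _ "axis i 1"])
      then have "(?T *v \<xi>) \<bullet> axis i 1 \<in> \<int>"
        using \<xi> by (auto simp: dual_lattice_def simp flip: inner)
      then show ?thesis by (simp add: inner_axis)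
    qed
    then show "\<xi> \<in> lattice_of (matrix_inv ?T)"
      unfolding lattice_of_def by (intro CollectI exI[of _ "?T *v \<xi>"]) (simp add: inv)
  next
    fix \<xi> assume "\<xi> \<in> lattice_of (matrix_inv ?T)"
    then obtain z where z: "\<xi> = matrix_inv ?T *v z" "\<And>i. z $ i \<in> \<int>"
      by (auto simp: lattice_of_def)
    have "\<xi> \<bullet> n \<in> \<int>" if "n \<in> lattice_of M" for n
    proof -
      obtain w where w: "n = M *v w" "\<And>i. w $ i \<in> \<int>"
        using \<open>n \<in> lattice_of M\<close> by (auto simp: lattice_of_def)
      have "\<xi> \<bullet> n = z \<bullet> w"
        unfolding w(1) inner unfolding z(1) inv ..
      then show ?thesis
        by (auto simp: inner_vec_def intro!: Ints_sum Ints_mult z(2) w(2))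
    qed
    then show "\<xi> \<in> dual_lattice (lattice_of M)"
      by (simp add: dual_lattice_def)
  qed
qed

text \<open>With \<open>A'\<close> and \<open>B'\<close> the preimages under \<open>M\<close>, the
  left side is d times the integer-lattice sum, each product of transforms of \<open>A\<close> and
  \<open>B\<close> is d^2 times that of \<open>A'\<close> and \<open>B'\<close>, and vol A vol B =
  d^2 vol A' vol B'. Both terms on the right therefore acquire 1 / d.\<close>

lemma poisson_lattice:
  fixes M :: "real ^ 'n ^ 'n" and A B :: "(real ^ 'n) set"
  assumes M: "invertible M" and A: "compact A" and B: "compact B"
  defines "L \<equiv> lattice_of M" and "d \<equiv> \<bar>det M\<bar>"
  shows "finite (interior (difference_set A B) \<inter> L)" (is ?fin)
    and "(\<lambda>\<xi>. fourier (indicator A) \<xi> * cnj (fourier (indicator B) \<xi>)) summable_on (dual_lattice L - {0})" (is ?summ)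
    and "complex_of_real (\<Sum>n\<in>interior (difference_set A B) \<inter> L. vol (A \<inter> translate B n))
      = complex_of_real (1 / d * vol A * vol B) + complex_of_real (1 / d) *
        (\<Sum>\<^sub>\<infinity>\<xi>\<in>dual_lattice L - {0}. fourier (indicator A) \<xi> * cnj (fourier (indicator B) \<xi>))" (is ?eq)
proof -
  define A' where "A' = (*v) (matrix_inv M) ` A"
  define B' where "B' = (*v) (matrix_inv M) ` B"
  have A': "compact A'" and B': "compact B'"
    using A B by (auto simp: A'_def B'_def intro: compact_matrix_image)
  have inv: "M *v (matrix_inv M *v x) = x" for x
    by (fact matrix_inv_vector_mult(1)[OF M])
  have AM: "A = (*v) M ` A'" and BM: "B = (*v) M ` B'"
    by (auto simp: A'_def B'_def image_image inv)
  have inj: "inj ((*v) M)" using M by (rule inj_matrix_vector_mult)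
  have d: "d > 0" using M by (simp add: d_def invertible_det_nz)

  have "difference_set A B = (*v) M ` difference_set A' B'"
    unfolding AM BM difference_set_def
    by (auto simp: matrix_vector_mult_diff_distrib[symmetric]) (use matrix_vector_mult_diff_distrib in blast)+
  \<comment> \<open>An injective linear map of the space to itself commutes with taking
    interiors.\<close>
  then have int: "interior (difference_set A B) = (*v) M ` interior (difference_set A' B')"
    using interior_injective_linear_image[OF matrix_vector_mul_linear inj] by metis
  let ?H = "{h. int_vec h \<in> interior (difference_set A' B')}"
  have injM: "inj (\<lambda>h. M *v int_vec h)"
    using inj inj_int_vec by (auto simp: inj_def)
  have idx: "interior (difference_set A B) \<inter> L = (\<lambda>h. M *v int_vec h) ` ?H"
    unfolding int L_def lattice_of_eq using inj by (auto simp: inj_def)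
  have "finite ?H"
    by (intro finite_bounded_int_vec bounded_interior compact_imp_bounded compact_difference_set A' B')
  then show ?fin unfolding idx by simp

  have vol_cross: "vol (A \<inter> translate B (M *v v)) = d * vol (A' \<inter> translate B' v)" for v
  proof -
    have "translate B (M *v v) = (*v) M ` translate B' v"
      unfolding BM translate_def by (auto simp: image_image matrix_vector_right_distrib)
    then have "A \<inter> translate B (M *v v) = (*v) M ` (A' \<inter> translate B' v)"
      unfolding AM using inj by (simp add: image_Int)
    then show ?thesis
      using vol_matrix_image[OF M, of "A' \<inter> translate B' v"] A' compact_translate[OF B']
      by (simp add: d_def compact_Int)
  qed

  let ?T = "matrix_inv (transpose M)"
  have T: "invertible (transpose M)" using M by (rule transpose_invertible)
  have invT: "transpose M *v (?T *v x) = x" for x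
    by (fact matrix_inv_vector_mult(1)[OF T])
  let ?F = "\<lambda>\<xi>. fourier (indicator A) \<xi> * cnj (fourier (indicator B) \<xi>)"
  let ?c = "\<lambda>h. fourier (indicator A') (int_vec h) * cnj (fourier (indicator B') (int_vec h))"
  \<comment> \<open>\<open>?g\<close> parametrises the dual lattice by integer vectors. Applying
    \<open>transpose M\<close> undoes \<open>?T\<close>, so the transforms of \<open>A'\<close> and
    \<open>B'\<close> are evaluated at integer points.\<close>
  let ?g = "\<lambda>h. ?T *v int_vec h"
  have "fourier (indicator A) \<xi> = of_real d * fourier (indicator A') (transpose M *v \<xi>)"
    "fourier (indicator B) \<xi> = of_real d * fourier (indicator B') (transpose M *v \<xi>)" for \<xi>
    unfolding AM BM d_def using fourier_matrix_image[OF M] A' B' by auto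
  then have Fg: "?F (?g h) = of_real (d * d) * ?c h" for h
    by (simp add: invT)
  let ?z = "\<lambda>_::'n. 0::int"
  have z: "int_vec ?z = 0" by (simp add: vec_eq_iff)
  have injg: "inj ?g"
  proof (rule injI)
    fix h k :: "'n \<Rightarrow> int" assume "?g h = ?g k"
    then have "int_vec h = int_vec k" by (metis invT)
    then show "h = k" by (rule injD[OF inj_int_vec])
  qed
  have bij: "bij_betw ?g (UNIV - {?z}) (dual_lattice L - {0})"
  proof -
    have "dual_lattice L = range ?g"
      unfolding L_def dual_lattice_of[OF M] by (rule lattice_of_eq)
    moreover have "?g ` (UNIV - {?z}) = range ?g - {?g ?z}"
      using image_set_diff[OF injg, of UNIV "{?z}"] by simp
    moreover have "?g ?z = 0" unfolding z by simp
    ultimately show ?thesis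
      unfolding bij_betw_def using inj_on_subset[OF injg subset_UNIV] by simp
  qed
  have c: "?c summable_on UNIV"
    by (rule abs_summable_summable[OF fourier_product_abs_summable[OF A' B']])
  have c': "?c summable_on (UNIV - {?z})"
    using c by (rule summable_on_subset_banach) auto
  have "(\<lambda>h. ?F (?g h)) summable_on (UNIV - {?z})"
    unfolding Fg by (intro summable_on_cmult_right c')
  then show ?summ
    using summable_on_reindex_bij_betw[OF bij, of ?F] by simp
  have "infsum ?F (dual_lattice L - {0}) = infsum (\<lambda>h. ?F (?g h)) (UNIV - {?z})"
    using infsum_reindex_bij_betw[OF bij, of ?F] by simp
  also have "\<dots> = of_real (d * d) * infsum ?c (UNIV - {?z})"
    unfolding Fg by (rule infsum_cmult_right') 
  finally have sumF: "infsum ?F (dual_lattice L - {0}) = of_real (d * d) * infsum ?c (UNIV - {?z})" .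
  have "infsum ?c UNIV = ?c ?z + infsum ?c (UNIV - {?z})"
    using infsum_Diff[OF c _ subset_UNIV, of "{?z}"] by simp
  also have "?c ?z = of_real (vol A' * vol B')"
    unfolding z using A' B' by (simp add: fourier_at_0)
  finally have split: "infsum ?c UNIV = of_real (vol A' * vol B') + infsum ?c (UNIV - {?z})" .
  have volAB: "vol A = d * vol A'" "vol B = d * vol B'"
    unfolding AM BM d_def using vol_matrix_image[OF M] A' B' by auto
  have "(\<Sum>n\<in>interior (difference_set A B) \<inter> L. vol (A \<inter> translate B n))
      = (\<Sum>h\<in>?H. d * vol (A' \<inter> translate B' (int_vec h)))"
    unfolding idx using injM by (subst sum.reindex) (auto simp: vol_cross intro: inj_on_subset)
  then have "complex_of_real (\<Sum>n\<in>interior (difference_set A B) \<inter> L. vol (A \<inter> translate B n))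
      = of_real d * complex_of_real (\<Sum>h\<in>?H. vol (A' \<inter> translate B' (int_vec h)))"
    by (simp add: sum_distrib_left)
  also have "\<dots> = of_real d * infsum ?c UNIV"
    unfolding poisson_int_lattice[OF A' B'] ..
  also have "\<dots> = of_real (1 / d * vol A * vol B) + of_real (1 / d) * infsum ?F (dual_lattice L - {0})"
    unfolding split sumF volAB using d by (simp add: field_simps)
  finally show ?eq .
qed

text \<open>The lattice 2L has covolume 2^n d, and its dual is half the dual of L. At half of a dual
  vector the transform of P is 2^n times that of (1/2) P at the vector itself. Squaring gives 4^n,
  and 4^n / (2^n d) = 2^n / d.\<close>

lemma poisson_symmetric_convex:
  fixes M :: "real ^ 'n ^ 'n" and P :: "(real ^ 'n) set"
  assumes M: "invertible M" and P: "compact P" "convex P" "centrally_symmetric P"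
  defines "L \<equiv> lattice_of M" and "d \<equiv> \<bar>det M\<bar>"
  shows "finite (interior P \<inter> L)" (is ?fin)
    and "(\<lambda>\<xi>. (cmod (fourier (indicator ((\<lambda>x. (1 / 2) *\<^sub>R x) ` P)) \<xi>))\<^sup>2) summable_on (dual_lattice L - {0})" (is ?summ)
    and "(\<Sum>n\<in>interior P \<inter> L. vol (P \<inter> translate P (2 *\<^sub>R n)))
      = 1 / d * ((vol P)\<^sup>2 / 2 ^ CARD('n)) + 2 ^ CARD('n) / d *
        (\<Sum>\<^sub>\<infinity>\<xi>\<in>dual_lattice L - {0}. (cmod (fourier (indicator ((\<lambda>x. (1 / 2) *\<^sub>R x) ` P)) \<xi>))\<^sup>2)" (is ?eq)
proof -
  let ?n = "CARD('n)"
  define D where "D = (mat 2 :: real ^ 'n ^ 'n)"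
  have Dv: "D *v x = 2 *\<^sub>R x" for x
    unfolding D_def
    by (simp add: vec_eq_iff matrix_vector_mult_def mat_def if_distrib[of "\<lambda>c. c * _"] cong: if_cong)
  have DM: "(D ** M) *v x = 2 *\<^sub>R (M *v x)" for x
    by (simp add: Dv flip: matrix_vector_mul_assoc)
  have detD: "det D = 2 ^ ?n"
    unfolding D_def by (subst det_diagonal) (auto simp: mat_def)
  then have D: "invertible D" by (simp add: invertible_det_nz)
  have M2: "invertible (D ** M)" using D M by (rule invertible_mult)
  have d2: "\<bar>det (D ** M)\<bar> = 2 ^ ?n * d" by (simp add: det_mul detD abs_mult d_def)
  have d: "d > 0" using M by (simp add: d_def invertible_det_nz)
  let ?L2 = "lattice_of (D ** M)"
  have L2: "?L2 = (*\<^sub>R) 2 ` L"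
    unfolding L_def lattice_of_def by (auto simp: DM)
  have neg: "- x \<in> P" if "x \<in> P" for x
    using that P(3) by (auto simp: centrally_symmetric_def)
  \<comment> \<open>By symmetry - b is in P, and a - b is twice the midpoint of a and - b;
    conversely 2p = p - (- p).\<close>
  have diff: "difference_set P P = (*\<^sub>R) 2 ` P"
  proof (intro equalityI subsetI)
    fix x assume "x \<in> difference_set P P"
    then obtain a b where ab: "a \<in> P" "b \<in> P" "x = a - b"
      by (auto simp: difference_set_def)
    have "(1/2) *\<^sub>R a + (1/2) *\<^sub>R (- b) \<in> P"
      using P(2) ab neg[of b] by (intro convexD) auto
    moreover have "x = 2 *\<^sub>R ((1/2) *\<^sub>R a + (1/2) *\<^sub>R (- b))"
      by (simp add: ab algebra_simps)
    ultimately show "x \<in> (*\<^sub>R) 2 ` P" by blast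
  next
    fix x assume "x \<in> (*\<^sub>R) 2 ` P"
    then obtain p where p: "p \<in> P" "x = p - (- p)"
      by (auto simp: scaleR_2)
    then show "x \<in> difference_set P P"
      unfolding difference_set_def using neg[of p] by blast
  qed
  have "interior (difference_set P P) = (*\<^sub>R) 2 ` interior P"
    unfolding diff by (rule interior_injective_linear_image) (auto simp: inj_def linear_scale_self)
  then have idx: "interior (difference_set P P) \<inter> ?L2 = (*\<^sub>R) 2 ` (interior P \<inter> L)"
    unfolding L2 by auto
  note main = poisson_lattice[OF M2 P(1) P(1), unfolded idx d2]
  have inj2: "inj_on ((*\<^sub>R) 2) S" for S :: "(real ^ 'n) set"
    by (auto simp: inj_on_def)
  show ?fin
    using main(1) inj2 by (rule finite_imageD)

  define Q where "Q = (\<lambda>x. (1 / 2) *\<^sub>R x) ` P"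
  have Q: "compact Q" unfolding Q_def using P(1) by (rule compact_scaling)
  have PQ: "P = (*v) D ` Q"
    by (auto simp: Q_def image_image Dv)
  have "transpose D = D" by (simp add: D_def transpose_mat)
  then have four: "fourier (indicator P) \<xi> = of_real (2 ^ ?n) * fourier (indicator Q) (2 *\<^sub>R \<xi>)" for \<xi>
    unfolding PQ using fourier_matrix_image[OF D Q, of \<xi>] by (simp add: detD Dv)
  \<comment> \<open>The factor 2 passes from the lattice vector to \<open>\<xi>\<close> in the inner
    product.\<close>
  have dual: "\<xi> \<in> dual_lattice ?L2 \<longleftrightarrow> 2 *\<^sub>R \<xi> \<in> dual_lattice L" for \<xi>
    unfolding L2 dual_lattice_def by auto
  let ?F = "\<lambda>\<xi>. fourier (indicator P) \<xi> * cnj (fourier (indicator P) \<xi>)"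
  let ?G = "\<lambda>\<xi>. (cmod (fourier (indicator Q) \<xi>))\<^sup>2"
  let ?g = "\<lambda>\<xi>::real^'n. (1/2) *\<^sub>R \<xi>"
  have bij: "bij_betw ?g (dual_lattice L - {0}) (dual_lattice ?L2 - {0})"
    by (rule bij_betwI[where g="(*\<^sub>R) 2"]) (auto simp: dual)
  have four_power: "(4::real) ^ ?n = 2 ^ ?n * 2 ^ ?n" by (simp flip: power_mult_distrib)
  have FG: "?F (?g \<xi>) = of_real (4 ^ ?n * ?G \<xi>)" for \<xi>
  proof -
    have "?F (?g \<xi>) = of_real (2 ^ ?n * 2 ^ ?n) * (fourier (indicator Q) \<xi> * cnj (fourier (indicator Q) \<xi>))"
      by (simp add: four)
    then show ?thesis
      by (simp only: complex_norm_square[symmetric] four_power of_real_mult)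
  qed
  have "(\<lambda>\<xi>. ?F (?g \<xi>)) summable_on (dual_lattice L - {0})"
    using main(2) summable_on_reindex_bij_betw[OF bij, of ?F] by simp
  \<comment> \<open>The known summability is that of a complex family with real values; taking real
    parts carries it over to the real family.\<close>
  then have s4: "(\<lambda>\<xi>. 4 ^ ?n * ?G \<xi>) summable_on (dual_lattice L - {0})"
    unfolding FG using summable_on_bounded_linear[OF bounded_linear_Re] by fastforce
  then show ?summ
    unfolding Q_def by (subst (asm) summable_on_cmult_right') simp_all
  have "infsum ?F (dual_lattice ?L2 - {0}) = infsum (\<lambda>\<xi>. ?F (?g \<xi>)) (dual_lattice L - {0})"
    using infsum_reindex_bij_betw[OF bij, of ?F] by simp
  also have "\<dots> = of_real (infsum (\<lambda>\<xi>. 4 ^ ?n * ?G \<xi>) (dual_lattice L - {0}))"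
    unfolding FG by (rule infsumI[OF has_sum_of_real[OF has_sum_infsum[OF s4]]])
  also have "infsum (\<lambda>\<xi>. 4 ^ ?n * ?G \<xi>) (dual_lattice L - {0}) = 4 ^ ?n * infsum ?G (dual_lattice L - {0})"
    by (rule infsum_cmult_right')
  finally have sumF: "infsum ?F (dual_lattice ?L2 - {0}) = of_real (4 ^ ?n * infsum ?G (dual_lattice L - {0}))" .
  have "complex_of_real (\<Sum>n\<in>interior P \<inter> L. vol (P \<inter> translate P (2 *\<^sub>R n)))
      = complex_of_real (1 / (2 ^ ?n * d) * vol P * vol P + 1 / (2 ^ ?n * d) * (4 ^ ?n * infsum ?G (dual_lattice L - {0})))"
    using main(3) unfolding sumF sum.reindex[OF inj2] o_def of_real_add of_real_mult .
  then have "(\<Sum>n\<in>interior P \<inter> L. vol (P \<inter> translate P (2 *\<^sub>R n)))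
      = 1 / (2 ^ ?n * d) * vol P * vol P + 1 / (2 ^ ?n * d) * (4 ^ ?n * infsum ?G (dual_lattice L - {0}))"
    by (simp only: of_real_eq_iff)
  then show ?eq
    unfolding Q_def[symmetric] four_power using d by (simp add: field_simps power2_eq_square)
qed

text \<open>Finiteness and summability are asserted along with the equations because
  \<open>sum\<close> over an infinite set and \<open>infsum\<close> of a non-summable family take
  the default value 0. The first equation is one between complex numbers, since the individual
  products of transforms need not be real.\<close>

theorem theorem2:
  fixes L :: "(real ^ 'n) set"
  assumes "full_rank_lattice L"
  shows
    "(\<forall>A B. compact A \<and> compact B \<longrightarrow>
        finite (interior (difference_set A B) \<inter> L) \<and>
        (\<lambda>\<xi>. fourier (indicator A) \<xi> * cnj (fourier (indicator B) \<xi>))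
          summable_on (dual_lattice L - {0}) \<and>
        complex_of_real (\<Sum>n\<in>interior (difference_set A B) \<inter> L. vol (A \<inter> translate B n)) =
          complex_of_real (1 / covolume L * vol A * vol B) +
          complex_of_real (1 / covolume L) *
            (\<Sum>\<^sub>\<infinity>\<xi>\<in>dual_lattice L - {0}.
               fourier (indicator A) \<xi> * cnj (fourier (indicator B) \<xi>))) \<and>
     (\<forall>P. compact P \<and> convex P \<and> centrally_symmetric P \<longrightarrow>
        finite (interior P \<inter> L) \<and>
        (\<lambda>\<xi>. (cmod (fourier (indicator ((\<lambda>x. (1 / 2) *\<^sub>R x) ` P)) \<xi>))\<^sup>2)
          summable_on (dual_lattice L - {0}) \<and>
        (\<Sum>n\<in>interior P \<inter> L. vol (P \<inter> translate P (2 *\<^sub>R n))) =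
          1 / covolume L * ((vol P)\<^sup>2 / 2 ^ CARD('n)) +
          2 ^ CARD('n) / covolume L *
            (\<Sum>\<^sub>\<infinity>\<xi>\<in>dual_lattice L - {0}.
               (cmod (fourier (indicator ((\<lambda>x. (1 / 2) *\<^sub>R x) ` P)) \<xi>))\<^sup>2))"
proof -
  obtain M where M: "invertible M" "L = lattice_of M"
    using assms by (auto simp: full_rank_lattice_def)
  show ?thesis
    unfolding M(2) covolume_lattice_of[OF M(1)]
    by (intro conjI allI impI; elim conjE;
        (rule poisson_lattice[OF M(1)] poisson_symmetric_convex[OF M(1)]; assumption))
qed

end
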